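(* Let $H$ be differentiable, let $V_*\in\mathbb{U}^{n\times k}$ be a solution of the NEPv $H(V)V=V\Lambda$ with $\delta_*:=\lambda_{k+1}(H(V_* ))-\lambda_k(H(V_* ))>0$, let $s_*:=\lambda_n(H(V_* ))-\lambda_1(H(V_* ))$, and suppose that the $\mathbb{R}$-linear operator $\mathscr{Q}:\mathbb{C}^{(n-k)\times k}\to\mathbb{C}^{(n-k)\times k}$, $$\mathscr{Q}(Z)=V_{*\perp}^{H}\,\mathbf{D}H(V_* )[V_{*\perp}Z]\,V_*+\Lambda_{*\perp}Z-Z\Lambda_*,$$ is self-adjoint and positive definite with respect to the inner product $\langle X,Y\rangle=\mathrm{Re}\,\mathrm{tr}(X^HY)$, with largest and smallest eigenvalues $\mu_{\max}\ge\mu_{\min}>0$. For $\sigma\in(-\delta_*,+\infty)$ let $H_\sigma(V):=H(V)-\sigma VV^H$ and $$\mathcal{L}_\sigma(Z)=D_\sigma(V_* )\odot\big(V_{*\perp}^{H}\,\mathbf{D}H_\sigma(V_* )[V_{*\perp}Z]\,V_*\big).$$ Then $$\rho(\mathcal{L}_\sigma)<1\quad\text{if}\quad 0<\frac{\mu_{\min}}{\sigma+s_*}\le\frac{\mu_{\max}}{\sigma+\delta_*}\le 2,$$ or equivalently, $$\rho(\mathcal{L}_\sigma)<1\quad\text{if}\quad \sigma\ge\frac{\mu_{\max}}{2}-\delta_*.$$ Hence for a sufficiently large $\sigma$ (namely, under this lower bound) the level-shifted SCF iteration with shift $\sigma$ is locally convergent to $V_*$.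
   Context: $\mathbb{U}^{n\times k}$ is the set of $n\times k$ complex matrices $V$ with $V^HV=I_k$ ($^H$ is conjugate transpose). $H:\mathbb{C}^{n\times k}\to\mathbb{C}^{n\times n}$ is a continuous Hermitian-matrix-valued function with $H(VQ)=H(V)$ for every $k\times k$ unitary $Q$. $\lambda_1(M)\le\dots\le\lambda_n(M)$ denote eigenvalues in ascending order. A solution of the NEPv (nonlinear eigenvalue problem with eigenvector dependency) is $V_*\in\mathbb{U}^{n\times k}$ with $H(V_* )V_*=V_*\Lambda_*$, where the eigenvalues of $\Lambda_*$ are the $k$ smallest eigenvalues of $H(V_* )$. Fix $H(V_* )[V_*,V_{*\perp}]=[V_*,V_{*\perp}]\,\mathrm{diag}(\Lambda_*,\Lambda_{*\perp})$ with $[V_*,V_{*\perp}]$ unitary, $\Lambda_*=\mathrm{diag}(\lambda_1,\dots,\lambda_k)$, $\Lambda_{*\perp}=\mathrm{diag}(\lambda_{k+1},\dots,\lambda_n)$, $\lambda_i=\lambda_i(H(V_* ))$. $H$ is differentiable if each entry of $H(V)$ is a smooth function of the real and imaginary parts of $V$; $\mathbf{D}H(V_* )[X]=\frac{d}{dt}H(V_*+tX)|_{t=0}$ ($t\in\mathbb{R}$), which is $\mathbb{R}$-linear in $X$. $\mathbf{D}H_\sigma(V_* )$ is defined likewise for $H_\sigma$. $D_\sigma(V_* )\in\mathbb{R}^{(n-k)\times k}$ has $(i,j)$ entry $(\lambda_{k+i}-\lambda_j+\sigma)^{-1}$, and $\odot$ is the entrywise product. For an $\mathbb{R}$-linear operator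 (additive and homogeneous over real scalars) on $\mathbb{C}^{(n-k)\times k}$, eigenvalues and the spectral radius $\rho$ (largest modulus of the complex eigenvalues) are those of a real $2(n-k)k\times2(n-k)k$ matrix representing it on $\mathbb{C}^{(n-k)\times k}$ viewed as a real vector space. Self-adjoint and positive definite means $\mathrm{Re}\,\mathrm{tr}(Y^H\mathscr{Q}(Z))=\mathrm{Re}\,\mathrm{tr}([\mathscr{Q}(Y)]^HZ)$ for all $Y,Z$, and $\mathrm{Re}\,\mathrm{tr}(Z^H\mathscr{Q}(Z))>0$ for all $Z\ne0$. Level-shifted SCF (self-consistent field) iteration with shift $\sigma$: given $V_0\in\mathbb{U}^{n\times k}$, $[H(V_i)-\sigma V_iV_i^H]V_{i+1}=V_{i+1}\Lambda_{i+1}$, $i=0,1,\dots$, with $V_{i+1}\in\mathbb{U}^{n\times k}$ a basis of the invariant subspace for the $k$ smallest eigenvalues of $H(V_i)-\sigma V_iV_i^H$. It is locally convergent to $V_*$ if $d(V_i,V_* )\to0$ as $i\to\infty$ for every $V_0$ with $d(V_0,V_* )$ sufficiently small, where $d(X,Y)=\|\Theta(X,Y)\|_{\mathrm{ui}}$; here $\Theta(X,Y)=\mathrm{diag}(\arccos\sigma_1,\dots,\arccos\sigma_k)$ with $\sigma_1\ge\dots\ge\sigma_k$ the singular values of $Y^HX$, and $\|\cdot\|_{\mathrm{ui}}$ is a unitarily invariant matrix norm (invariant under left and right multiplication by unitaries and equal to the spectral norm on rank-1 matrices).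
   Formalization: The bounds "≤ 2" and "σ ≥ μ_max/2 − δ_*" are made strict for ρ < 1 and for local convergence, since at equality the claim fails (H = diag(0,1), V_* = e_1, σ = −1/2 gives ρ = 1); at equality only ρ ≤ 1 is asserted. *)

theory Defs
  imports "HOL-Analysis.Analysis" "HOL-Computational_Algebra.Computational_Algebra"
begin

section \<open>Complex matrices\<close>

text \<open>\<open>('a, 'b) cmat\<close> has rows indexed by \<open>'a\<close> and columns by \<open>'b\<close>. The types \<open>'n\<close>, \<open>'k\<close>, \<open>'m\<close>
  stand for the index sets of sizes \<open>n\<close>, \<open>k\<close>, \<open>n - k\<close>.\<close>

type_synonym ('a, 'b) cmat = "complex^'b^'a"
type_synonym ('a, 'b) rmat = "real^'b^'a"

definition ctranspose :: "('a::finite, 'b::finite) cmat \<Rightarrow> ('b, 'a) cmat" where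
  "ctranspose A = (\<chi> i j. cnj (A $ j $ i))"

definition hermitian :: "('n::finite, 'n) cmat \<Rightarrow> bool" where
  "hermitian A \<longleftrightarrow> ctranspose A = A"

definition stiefel :: "('n::finite, 'k::finite) cmat set" where
  "stiefel = {V. ctranspose V ** V = mat 1}"

definition unitary :: "('a::finite, 'b::finite) cmat \<Rightarrow> bool" where
  "unitary U \<longleftrightarrow> ctranspose U ** U = mat 1 \<and> U ** ctranspose U = mat 1"

definition hcat :: "('n::finite, 'k::finite) cmat \<Rightarrow> ('n, 'm::finite) cmat \<Rightarrow> ('n, 'k + 'm) cmat" where
  "hcat V W = (\<chi> i s. case s of Inl j \<Rightarrow> V $ i $ j | Inr j \<Rightarrow> W $ i $ j)"

definition diag :: "('a::finite \<Rightarrow> complex) \<Rightarrow> ('a, 'a) cmat" where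
  "diag d = (\<chi> i j. if i = j then d i else 0)"

definition hadamard :: "('a::finite, 'b::finite) rmat \<Rightarrow> ('a, 'b) cmat \<Rightarrow> ('a, 'b) cmat" where
  "hadamard D A = (\<chi> i j. of_real (D $ i $ j) * A $ i $ j)"

text \<open>The position, counted from 1, of an element of a finite linearly ordered index type.\<close>

definition pos :: "'a::{finite,linorder} \<Rightarrow> nat" where
  "pos j = card {i. i \<le> j}"

section \<open>Eigenvalues of matrices\<close>

definition charpoly :: "('n::finite, 'n) cmat \<Rightarrow> complex poly" where
  "charpoly A = det (\<chi> i j. (if i = j then [:0, 1:] else 0) - [:A $ i $ j:])"

text \<open>Eigenvalues with algebraic multiplicity.\<close>

definition eigenvalues :: "('n::finite, 'n) cmat \<Rightarrow> complex multiset" where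
  "eigenvalues A = proots (charpoly A)"

text \<open>Meaningful for matrices with real spectrum, in particular Hermitian ones.\<close>

definition ascending_eigenvalues :: "('n::finite, 'n) cmat \<Rightarrow> real list" where
  "ascending_eigenvalues A = sorted_list_of_multiset (image_mset Re (eigenvalues A))"

definition lam :: "nat \<Rightarrow> ('n::finite, 'n) cmat \<Rightarrow> real" where
  "lam i A = ascending_eigenvalues A ! (i - 1)"

definition smallest_eigenbasis :: "('n::finite, 'n) cmat \<Rightarrow> ('n, 'k::finite) cmat \<Rightarrow> bool" where
  "smallest_eigenbasis M V \<longleftrightarrow> V \<in> stiefel \<and>
     (\<exists>\<Lambda> :: ('k, 'k) cmat. M ** V = V ** \<Lambda> \<and>
        eigenvalues \<Lambda> = mset (map of_real (take CARD('k) (ascending_eigenvalues M))))"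

section \<open>Real-linear operators\<close>

text \<open>On \<open>('m, 'k) cmat\<close> the inner product \<open>X \<bullet> Y\<close> of the library is \<open>Re (tr (X\<^sup>H Y))\<close>, and
  \<open>Basis\<close> consists of the matrices with a single nonzero entry, equal to \<open>1\<close> or \<open>\<i>\<close>.
  The real matrix representing \<open>L\<close> is indexed by \<open>Basis\<close> itself.\<close>

definition real_matrix :: "('a::euclidean_space \<Rightarrow> 'a) \<Rightarrow> 'a \<Rightarrow> 'a \<Rightarrow> real" where
  "real_matrix L b c = b \<bullet> L c"

definition op_eigenvalue :: "('a::euclidean_space \<Rightarrow> 'a) \<Rightarrow> complex \<Rightarrow> bool" where
  "op_eigenvalue L \<mu> \<longleftrightarrow>
     (\<exists>v :: 'a \<Rightarrow> complex. (\<exists>b\<in>Basis. v b \<noteq> 0) \<and>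
        (\<forall>b\<in>Basis. (\<Sum>c\<in>Basis. of_real (real_matrix L b c) * v c) = \<mu> * v b))"

definition op_spectral_radius :: "('a::euclidean_space \<Rightarrow> 'a) \<Rightarrow> real" where
  "op_spectral_radius L = Max (cmod ` {\<mu>. op_eigenvalue L \<mu>})"

definition largest_eigenvalue :: "('a::euclidean_space \<Rightarrow> 'a) \<Rightarrow> real" where
  "largest_eigenvalue L = Max {\<mu>. op_eigenvalue L (of_real \<mu>)}"

definition smallest_eigenvalue :: "('a::euclidean_space \<Rightarrow> 'a) \<Rightarrow> real" where
  "smallest_eigenvalue L = Min {\<mu>. op_eigenvalue L (of_real \<mu>)}"

definition self_adjoint :: "(('m::finite, 'k::finite) cmat \<Rightarrow> ('m, 'k) cmat) \<Rightarrow> bool" where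
  "self_adjoint Q \<longleftrightarrow>
     (\<forall>Y Z. Re (trace (ctranspose Y ** Q Z)) = Re (trace (ctranspose (Q Y) ** Z)))"

definition positive_definite :: "(('m::finite, 'k::finite) cmat \<Rightarrow> ('m, 'k) cmat) \<Rightarrow> bool" where
  "positive_definite Q \<longleftrightarrow> (\<forall>Z. Z \<noteq> 0 \<longrightarrow> Re (trace (ctranspose Z ** Q Z)) > 0)"

section \<open>Differentiability\<close>

text \<open>Derivatives are taken over the reals, so for functions of a complex matrix these are the usual
  classes \<open>C\<^sup>r\<close> of functions of the real and imaginary parts of its entries; in finite dimension,
  \<open>C\<^sup>r\<close> for all directional derivatives amounts to \<open>C\<^sup>r\<close> for the derivative.\<close>

primrec C_diff :: "nat \<Rightarrow> ('a::euclidean_space \<Rightarrow> 'b::real_normed_vector) \<Rightarrow> bool" where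
  "C_diff 0 f \<longleftrightarrow> continuous_on UNIV f"
| "C_diff (Suc r) f \<longleftrightarrow>
     (\<exists>f'. (\<forall>x. (f has_derivative f' x) (at x)) \<and> (\<forall>v. C_diff r (\<lambda>x. f' x v)))"

definition smooth :: "('a::euclidean_space \<Rightarrow> 'b::real_normed_vector) \<Rightarrow> bool" where
  "smooth f \<longleftrightarrow> (\<forall>r. C_diff r f)"

definition differentiable_entries :: "(('n::finite, 'k::finite) cmat \<Rightarrow> ('n, 'n) cmat) \<Rightarrow> bool" where
  "differentiable_entries H \<longleftrightarrow> (\<forall>i j. smooth (\<lambda>V. H V $ i $ j))"

definition dirderiv ::
    "(('n::finite, 'k::finite) cmat \<Rightarrow> ('n, 'n) cmat) \<Rightarrow> ('n, 'k) cmat \<Rightarrow> ('n, 'k) cmat \<Rightarrow> ('n, 'n) cmat" where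
  "dirderiv H V X = vector_derivative (\<lambda>t::real. H (V + t *\<^sub>R X)) (at 0)"

section \<open>Distances between subspaces\<close>

definition descending_singular_values :: "('k::finite, 'k) cmat \<Rightarrow> real list" where
  "descending_singular_values A = rev (map sqrt (ascending_eigenvalues (ctranspose A ** A)))"

definition canonical_angles ::
    "('n::finite, 'k::{finite,linorder}) cmat \<Rightarrow> ('n, 'k) cmat \<Rightarrow> ('k, 'k) cmat" where
  "canonical_angles X Y =
     diag (\<lambda>j. of_real (arccos (descending_singular_values (ctranspose Y ** X) ! (pos j - 1))))"

text \<open>\<open>onorm\<close> is taken with respect to the Euclidean norm, so it is the spectral norm.\<close>

definition unitarily_invariant_norm :: "(('k::finite, 'k) cmat \<Rightarrow> real) \<Rightarrow> bool" where
  "unitarily_invariant_norm N \<longleftrightarrow>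
     (\<forall>A. 0 \<le> N A) \<and> (\<forall>A. N A = 0 \<longleftrightarrow> A = 0) \<and>
     (\<forall>c A. N (\<chi> i j. c * A $ i $ j) = cmod c * N A) \<and>
     (\<forall>A B. N (A + B) \<le> N A + N B) \<and>
     (\<forall>A U W. unitary U \<longrightarrow> unitary W \<longrightarrow> N (U ** A ** W) = N A) \<and>
     (\<forall>A. rank A = 1 \<longrightarrow> N A = onorm (\<lambda>x. A *v x))"

definition subspace_dist ::
    "(('k::{finite,linorder}, 'k) cmat \<Rightarrow> real) \<Rightarrow> ('n::finite, 'k) cmat \<Rightarrow> ('n, 'k) cmat \<Rightarrow> real" where
  "subspace_dist N X Y = N (canonical_angles X Y)"

section \<open>Eigenvector-dependent eigenvalue problems and level-shifted SCF\<close>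

definition nepv_solution :: "(('n::finite, 'k::finite) cmat \<Rightarrow> ('n, 'n) cmat) \<Rightarrow> ('n, 'k) cmat \<Rightarrow> bool" where
  "nepv_solution H V \<longleftrightarrow> smallest_eigenbasis (H V) V"

definition level_shifted ::
    "real \<Rightarrow> (('n::finite, 'k::finite) cmat \<Rightarrow> ('n, 'n) cmat) \<Rightarrow> ('n, 'k) cmat \<Rightarrow> ('n, 'n) cmat" where
  "level_shifted \<sigma> H V = H V - \<sigma> *\<^sub>R (V ** ctranspose V)"

definition level_shifted_scf ::
    "real \<Rightarrow> (('n::finite, 'k::finite) cmat \<Rightarrow> ('n, 'n) cmat) \<Rightarrow> (nat \<Rightarrow> ('n, 'k) cmat) \<Rightarrow> bool" where
  "level_shifted_scf \<sigma> H V \<longleftrightarrow>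
     V 0 \<in> stiefel \<and> (\<forall>i. smallest_eigenbasis (level_shifted \<sigma> H (V i)) (V (Suc i)))"

text \<open>When eigenvalues coincide, the iterates are not unique; all admissible choices have to converge.\<close>

definition locally_convergent ::
    "(('k::{finite,linorder}, 'k) cmat \<Rightarrow> real) \<Rightarrow> real \<Rightarrow> (('n::finite, 'k) cmat \<Rightarrow> ('n, 'n) cmat) \<Rightarrow>
      ('n, 'k) cmat \<Rightarrow> bool" where
  "locally_convergent N \<sigma> H Vs \<longleftrightarrow>
     (\<exists>\<epsilon>>0. \<forall>V. level_shifted_scf \<sigma> H V \<longrightarrow> subspace_dist N (V 0) Vs < \<epsilon> \<longrightarrow>
        (\<lambda>i. subspace_dist N (V i) Vs) \<longlonglongrightarrow> 0)"

definition D_shift ::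
    "real \<Rightarrow> ('n::finite, 'n) cmat \<Rightarrow> ('m::{finite,linorder}, 'k::{finite,linorder}) rmat" where
  "D_shift \<sigma> M = (\<chi> i j. 1 / (lam (CARD('k) + pos i) M - lam (pos j) M + \<sigma>))"

definition Q_op ::
    "(('n::finite, 'k::finite) cmat \<Rightarrow> ('n, 'n) cmat) \<Rightarrow> ('n, 'k) cmat \<Rightarrow> ('n, 'm::finite) cmat \<Rightarrow>
      ('k, 'k) cmat \<Rightarrow> ('m, 'm) cmat \<Rightarrow> ('m, 'k) cmat \<Rightarrow> ('m, 'k) cmat" where
  "Q_op H V Vp \<Lambda> \<Lambda>p Z = ctranspose Vp ** dirderiv H V (Vp ** Z) ** V + \<Lambda>p ** Z - Z ** \<Lambda>"

definition L_op ::
    "real \<Rightarrow> (('n::finite, 'k::{finite,linorder}) cmat \<Rightarrow> ('n, 'n) cmat) \<Rightarrow> ('n, 'k) cmat \<Rightarrow>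
      ('n, 'm::{finite,linorder}) cmat \<Rightarrow> ('m, 'k) cmat \<Rightarrow> ('m, 'k) cmat" where
  "L_op \<sigma> H V Vp Z =
     hadamard (D_shift \<sigma> (H V))
       (ctranspose Vp ** dirderiv (level_shifted \<sigma> H) V (Vp ** Z) ** V)"

end

(* Let the weights D be those of the level shift at Vs and put T Z = Z / D entrywise. The shift enters the
   derivative only through - sigma Z, so the operator of the theorem is L Z = T^-1 (Q Z) - Z. It is self-adjoint
   for the inner product <X, T Z>, and its quadratic form lies between mu_min / (sigma + s) - 1 and
   mu_max / (sigma + delta) - 1 times <Z, T Z>. Hence its spectral radius is at most the larger modulus q of these
   two numbers, and if q < 1 it is a contraction in the T-norm.

   For the convergence, choose the basis V of a nearby subspace so that Vs^H V is the identity up to second order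
   in Y = Vp^H V (polar decomposition). By Ky Fan's trace minimality and the spectral gap, the component Y' of the
   next iterate tends to 0 with Y, and its Sylvester equation linearizes to Y' = - L Y + o(|Y| + |Y'|). So the
   T-norm of Y decreases geometrically, and |Y| is comparable with the norm of the canonical angles. *)

theory Submission
  imports Defs
begin

text \<open>The derivative of \<open>H\<close> may conjugate its argument, so L is only real linear.
  Spectral arguments therefore use the real inner product Re tr(X^H Y), and a complex eigenvector is
  treated as a pair of real ones. The weights of T lie between sigma + delta and sigma + s, which is
  where the two denominators come from.

  The main obstacle is that an iterate is determined only up to a unitary factor on the right, so
  the bases need not converge even when their subspaces do. The induction therefore carries a
  rotated representative of each iterate; this is legitimate because both \<open>H V\<close> and V
  V^H are blind to the rotation.

  Trace minimality gives only |Y'|^2 = O(|Y|), a square root worse than the final linear estimate.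
  It suffices because each remainder in the Sylvester equation is Y or Y' times a factor that
  becomes small; the crude bound only has to control these factors. Thus neither uniqueness of the
  next eigenspace nor convergence of individual eigenvectors ever enters.\<close>

no_notation fps_nth (infixl \<open>$\<close> 75)

section \<open>Matrix algebra\<close>

lemma ctranspose_nth [simp]: "ctranspose A $ i $ j = cnj (A $ j $ i)"
  by (simp add: ctranspose_def)

lemma ctranspose_ctranspose [simp]: "ctranspose (ctranspose A) = A"
  by (simp add: vec_eq_iff)

lemma ctranspose_mult [simp]: "ctranspose (A ** B) = ctranspose B ** ctranspose A"
  by (simp add: vec_eq_iff matrix_matrix_mult_def mult.commute)

lemma ctranspose_add [simp]: "ctranspose (A + B) = ctranspose A + ctranspose B"
  by (simp add: vec_eq_iff)

lemma ctranspose_diff [simp]: "ctranspose (A - B) = ctranspose A - ctranspose B"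
  by (simp add: vec_eq_iff)

lemma ctranspose_scaleR [simp]: "ctranspose (c *\<^sub>R A) = c *\<^sub>R ctranspose A"
  by (simp add: vec_eq_iff)

lemma ctranspose_mat_1 [simp]: "ctranspose (mat 1) = mat 1"
  by (auto simp: vec_eq_iff mat_def)

lemma ctranspose_diag_of_real [simp]:
  "ctranspose (diag (\<lambda>i. of_real (d i))) = diag (\<lambda>i. of_real (d i))"
  by (simp add: vec_eq_iff diag_def)

lemma matrix_add_rdistrib: "(A + B) ** C = A ** C + B ** (C :: ('a::finite,'b::finite) cmat)"
  by (simp add: vec_eq_iff matrix_matrix_mult_def algebra_simps sum.distrib)

lemma matrix_diff_ldistrib: "A ** (B - C) = A ** B - A ** (C :: ('a::finite,'b::finite) cmat)"
  by (simp add: vec_eq_iff matrix_matrix_mult_def algebra_simps sum_subtractf)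

lemma matrix_diff_rdistrib: "(A - B) ** C = A ** C - B ** (C :: ('a::finite,'b::finite) cmat)"
  by (simp add: vec_eq_iff matrix_matrix_mult_def algebra_simps sum_subtractf)

lemma matrix_mul_0 [simp]:
  "A ** 0 = (0 :: ('a::finite,'b::finite) cmat)" "0 ** B = (0 :: ('a::finite,'b::finite) cmat)"
  by (simp_all add: vec_eq_iff matrix_matrix_mult_def)

lemma matrix_scaleR_left: "(c *\<^sub>R A) ** B = c *\<^sub>R (A ** (B :: ('a::finite,'b::finite) cmat))"
  by (simp add: vec_eq_iff matrix_matrix_mult_def scaleR_sum_right)

lemma matrix_scaleR_right: "A ** (c *\<^sub>R B) = c *\<^sub>R (A ** (B :: ('a::finite,'b::finite) cmat))"
  by (simp add: vec_eq_iff matrix_matrix_mult_def scaleR_sum_right)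

lemmas cmat_algebra = matrix_add_ldistrib matrix_add_rdistrib matrix_diff_ldistrib
  matrix_diff_rdistrib matrix_scaleR_left matrix_scaleR_right matrix_mul_assoc

lemma diag_mult_nth [simp]: "(diag d ** A) $ i $ j = d i * A $ i $ j"
  by (simp add: diag_def matrix_matrix_mult_def if_distrib if_distribR cong: if_cong)

lemma mult_diag_nth [simp]: "(A ** diag d) $ i $ j = A $ i $ j * d j"
  by (simp add: diag_def matrix_matrix_mult_def if_distrib if_distribR cong: if_cong)

lemma diag_mult_diag: "diag d ** diag e = diag (\<lambda>i. d i * e i)"
  by (auto simp: vec_eq_iff) (simp_all add: diag_def)

section \<open>Real inner product and Frobenius norm\<close>

lemma inner_cmat: "A \<bullet> B = Re (trace (ctranspose A ** B))" for A B :: "('a::finite,'b::finite) cmat"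
  unfolding trace_def matrix_matrix_mult_def inner_vec_def
  by (simp add: inner_complex_def) (rule sum.swap)

lemma inner_ctranspose: "ctranspose A \<bullet> ctranspose B = A \<bullet> B" for A :: "('a::finite,'b::finite) cmat"
  unfolding inner_vec_def by (simp add: inner_complex_def) (rule sum.swap)

lemma norm_ctranspose [simp]: "norm (ctranspose A) = norm A"
  by (simp add: norm_eq_sqrt_inner inner_ctranspose)

lemma norm_cmat_sq: "(norm A)\<^sup>2 = (\<Sum>i\<in>UNIV. \<Sum>j\<in>UNIV. (cmod (A $ i $ j))\<^sup>2)"
  for A :: "('a::finite,'b::finite) cmat"
  by (simp add: norm_vec_def L2_set_def sum_nonneg)

text \<open>Cauchy-Schwarz in each entry. The library norm on nested vectors is the Frobenius norm,
  so every norm estimate below is in that norm and picks up factors sqrt k from matrices with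
  orthonormal columns.\<close>

lemma norm_matrix_mult_le: "norm (A ** B) \<le> norm A * norm B"
  for A :: "('a::finite,'b::finite) cmat" and B :: "('b,'c::finite) cmat"
proof (rule power2_le_imp_le)
  have entry: "(cmod ((A ** B) $ i $ j))\<^sup>2
      \<le> (\<Sum>l\<in>UNIV. (cmod (A $ i $ l))\<^sup>2) * (\<Sum>l\<in>UNIV. (cmod (B $ l $ j))\<^sup>2)" for i j
  proof -
    have "cmod ((A ** B) $ i $ j) \<le> (\<Sum>l\<in>UNIV. cmod (A $ i $ l) * cmod (B $ l $ j))"
      unfolding matrix_matrix_mult_def using norm_sum by (simp flip: norm_mult)
    then have "(cmod ((A ** B) $ i $ j))\<^sup>2 \<le> (\<Sum>l\<in>UNIV. cmod (A $ i $ l) * cmod (B $ l $ j))\<^sup>2"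
      by (intro power_mono) auto
    also have "\<dots> \<le> (\<Sum>l\<in>UNIV. (cmod (A $ i $ l))\<^sup>2) * (\<Sum>l\<in>UNIV. (cmod (B $ l $ j))\<^sup>2)"
      by (rule Cauchy_Schwarz_ineq_sum)
    finally show ?thesis .
  qed
  have "(norm (A ** B))\<^sup>2 \<le> (\<Sum>i\<in>UNIV. \<Sum>j\<in>UNIV.
      (\<Sum>l\<in>UNIV. (cmod (A $ i $ l))\<^sup>2) * (\<Sum>l\<in>UNIV. (cmod (B $ l $ j))\<^sup>2))"
    unfolding norm_cmat_sq by (intro sum_mono entry)
  also have "\<dots> = (\<Sum>i\<in>UNIV. \<Sum>l\<in>UNIV. (cmod (A $ i $ l))\<^sup>2) * (\<Sum>j\<in>UNIV. \<Sum>l\<in>UNIV. (cmod (B $ l $ j))\<^sup>2)"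
    by (simp add: sum_product)
  also have "(\<Sum>j\<in>UNIV. \<Sum>l\<in>UNIV. (cmod (B $ l $ j))\<^sup>2) = (norm B)\<^sup>2"
    unfolding norm_cmat_sq by (rule sum.swap)
  finally show "(norm (A ** B))\<^sup>2 \<le> (norm A * norm B)\<^sup>2"
    by (simp add: norm_cmat_sq power_mult_distrib)
qed simp

lemma norm_mult_unitary:
  fixes A :: "('a::finite,'b::finite) cmat"
  assumes "U ** ctranspose U = mat 1" shows "norm (A ** U) = norm A"
proof -
  have "trace (ctranspose (A ** U) ** (A ** U)) = trace ((ctranspose A ** A) ** (U ** ctranspose U))"
    by (simp add: cmat_algebra) (metis matrix_mul_assoc trace_mul_sym)
  then show ?thesis
    using assms by (simp add: norm_eq_sqrt_inner inner_cmat del: ctranspose_mult)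
qed

section \<open>Matrices with orthonormal columns\<close>

lemma stiefelD: "V \<in> stiefel \<Longrightarrow> ctranspose V ** V = mat 1"
  by (simp add: stiefel_def)

lemma norm_stiefel_sq: "V \<in> stiefel \<Longrightarrow> (norm V)\<^sup>2 = CARD('k)" for V :: "('n::finite,'k::finite) cmat"
  by (simp add: power2_norm_eq_inner inner_cmat stiefelD trace_I)

lemma norm_stiefel: "V \<in> stiefel \<Longrightarrow> norm V = sqrt CARD('k)" for V :: "('n::finite,'k::finite) cmat"
  by (metis norm_ge_zero norm_stiefel_sq real_sqrt_abs abs_of_nonneg)

lemma stiefel_mult_unitary:
  assumes "V \<in> stiefel" "unitary Q" shows "V ** Q \<in> stiefel"
proof -
  have "ctranspose (V ** Q) ** (V ** Q) = ctranspose Q ** (ctranspose V ** V) ** Q"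
    by (simp add: matrix_mul_assoc)
  then show ?thesis using assms by (simp add: stiefel_def unitary_def)
qed

lemma unitaryI_left:
  fixes U :: "('a::finite,'a) cmat"
  assumes "ctranspose U ** U = mat 1" shows "unitary U"
  using assms matrix_left_right_inverse by (auto simp: unitary_def)

lemma unitary_ctranspose: "unitary U \<Longrightarrow> unitary (ctranspose U)"
  by (simp add: unitary_def)

lemma unitary_mult: "unitary U \<Longrightarrow> unitary W \<Longrightarrow> unitary (U ** W)"
  unfolding unitary_def by (metis ctranspose_mult matrix_mul_assoc matrix_mul_rid)

lemma bounded_linear_ctranspose: "bounded_linear (ctranspose :: ('a::finite,'b::finite) cmat \<Rightarrow> _)"
  by (simp add: linear_conv_bounded_linear[symmetric] linearI)

lemma bounded_bilinear_matrix_mult: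
  "bounded_bilinear ((**) :: ('a::finite,'b::finite) cmat \<Rightarrow> ('b,'c::finite) cmat \<Rightarrow> _)"
proof
  show "\<exists>K. \<forall>A B. norm (A ** B :: ('a,'c) cmat) \<le> norm (A :: ('a,'b) cmat) * norm B * K"
    by (rule exI[of _ 1]) (simp add: norm_matrix_mult_le)
qed (simp_all add: cmat_algebra)

lemmas continuous_on_matrix_mult [continuous_intros] =
  bounded_bilinear.continuous_on[OF bounded_bilinear_matrix_mult]
lemmas continuous_on_ctranspose [continuous_intros] =
  bounded_linear.continuous_on[OF bounded_linear_ctranspose]

section \<open>Hermitian matrices\<close>

lemma hermitianD: "hermitian A \<Longrightarrow> ctranspose A = A"
  by (simp add: hermitian_def)

lemma hermitian_nth: "hermitian A \<Longrightarrow> cnj (A $ i $ j) = A $ j $ i"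
  by (metis ctranspose_nth hermitianD)

text \<open>All members have norm sqrt k and the defining equation is closed. Compactness supplies
  the maximizer in \<open>hermitian_diagonalization\<close>.\<close>

lemma compact_stiefel: "compact (stiefel :: ('n::finite,'k::finite) cmat set)"
proof -
  have "continuous_on UNIV (\<lambda>V :: ('n,'k) cmat. ctranspose V ** V)"
    by (intro continuous_intros)
  then have "closed (stiefel :: ('n,'k) cmat set)"
    unfolding stiefel_def by (rule closed_Collect_eq) simp
  moreover have "bounded (stiefel :: ('n,'k) cmat set)"
    by (rule boundedI[of _ "sqrt CARD('k)"]) (simp add: norm_stiefel)
  ultimately show ?thesis by (simp add: compact_eq_bounded_closed)
qed

section \<open>Complex plane rotations\<close>

lemma sum_two_support:
  fixes x :: "'a::finite \<Rightarrow> complex"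
  assumes "i \<noteq> j"
  shows "(\<Sum>r\<in>UNIV. (if r = i then a else if r = j then b else 0) * x r) = a * x i + b * x j"
proof -
  have "(\<Sum>r\<in>UNIV. (if r = i then a else if r = j then b else 0) * x r)
      = (\<Sum>r\<in>{i,j}. (if r = i then a else if r = j then b else 0) * x r)"
    by (rule sum.mono_neutral_right) auto
  then show ?thesis using assms by simp
qed

text \<open>The complex Givens rotation in the plane of coordinates i and j, with cosine c, sine s
  and phase w: column i is c e_i + s w e_j and column j is - s cnj(w) e_i + c e_j.\<close>

definition plane_rotation :: "'n::finite \<Rightarrow> 'n \<Rightarrow> real \<Rightarrow> real \<Rightarrow> complex \<Rightarrow> ('n,'n) cmat" where
  "plane_rotation i j c s w = (\<chi> r l.
     if l = i then (if r = i then of_real c else if r = j then of_real s * w else 0)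
     else if l = j then (if r = i then - of_real s * cnj w else if r = j then of_real c else 0)
     else if r = l then 1 else 0)"

lemma sum_plane_rotation:
  assumes "i \<noteq> j"
  shows "(\<Sum>r\<in>UNIV. plane_rotation i j c s w $ r $ l * x r) =
    (if l = i then of_real c * x i + of_real s * w * x j
     else if l = j then - of_real s * cnj w * x i + of_real c * x j else x l)"
proof -
  consider "l = i" | "l = j" | "l \<noteq> i" "l \<noteq> j" by blast
  then show ?thesis
  proof cases
    case 3
    then show ?thesis
      by (simp add: plane_rotation_def if_distribR if_distrib[of "\<lambda>x. x * _"] cong: if_cong)
  qed (use assms in \<open>simp_all add: plane_rotation_def sum_two_support\<close>)
qed

lemma sum_cnj_plane_rotation:
  assumes "i \<noteq> j"
  shows "(\<Sum>r\<in>UNIV. cnj (plane_rotation i j c s w $ r $ l) * x r) =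
    (if l = i then of_real c * x i + of_real s * cnj w * x j
     else if l = j then - of_real s * w * x i + of_real c * x j else x l)"
proof -
  have "(\<Sum>r\<in>UNIV. cnj (plane_rotation i j c s w $ r $ l) * x r)
     = cnj (\<Sum>r\<in>UNIV. plane_rotation i j c s w $ r $ l * cnj (x r))"
    by simp
  then show ?thesis
    unfolding sum_plane_rotation[OF assms] by simp
qed

lemma plane_rotation_stiefel:
  assumes "i \<noteq> j" "c\<^sup>2 + s\<^sup>2 = 1" "cmod w = 1"
  shows "plane_rotation i j c s w \<in> stiefel"
proof -
  have w: "w * cnj w = 1" "cnj w * w = 1"
    using assms(3) by (simp_all flip: complex_norm_square add: mult.commute[of "cnj w"])
  have cs: "complex_of_real c * of_real c + of_real s * of_real s = 1"
    using assms(2) by (simp add: power2_eq_square flip: of_real_mult of_real_add)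
  have cs': "complex_of_real c * of_real c + of_real s * w * (of_real s * cnj w) = 1"
    "complex_of_real c * of_real c + of_real s * cnj w * (of_real s * w) = 1"
    using cs w by (metis mult.assoc mult.commute mult.right_neutral)+
  have "(ctranspose (plane_rotation i j c s w) ** plane_rotation i j c s w) $ a $ b
      = mat 1 $ a $ b" for a b
  proof -
    have "(ctranspose (plane_rotation i j c s w) ** plane_rotation i j c s w) $ a $ b
        = (\<Sum>r\<in>UNIV. cnj (plane_rotation i j c s w $ r $ a) * plane_rotation i j c s w $ r $ b)"
      by (simp add: matrix_matrix_mult_def)
    also have "\<dots> = mat 1 $ a $ b"
      unfolding sum_cnj_plane_rotation[OF assms(1)] using assms(1) cs'
      by (auto simp: plane_rotation_def mat_def algebra_simps)
    finally show ?thesis .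
  qed
  then show ?thesis by (simp add: stiefel_def vec_eq_iff)
qed

text \<open>For small s the first-order effect on the diagonal is the term with Re (w B_ij), added
  at i and subtracted at j. A weighted trace with different weights at i and j therefore detects a
  nonzero off-diagonal entry.\<close>

lemma plane_rotation_conj_diag:
  assumes "i \<noteq> j" "hermitian B" "cmod w = 1"
  shows "Re ((ctranspose (plane_rotation i j c s w) ** B ** plane_rotation i j c s w) $ l $ l) =
    (if l = i then c\<^sup>2 * Re (B $ i $ i) + s\<^sup>2 * Re (B $ j $ j) + 2 * c * s * Re (w * B $ i $ j)
     else if l = j then s\<^sup>2 * Re (B $ i $ i) + c\<^sup>2 * Re (B $ j $ j) - 2 * c * s * Re (w * B $ i $ j)
     else Re (B $ l $ l))"
proof -
  have w: "Re w * Re w + Im w * Im w = 1"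
    using assms(3) by (metis cmod_power2 one_power2 power2_eq_square)
  have Bji: "B $ j $ i = cnj (B $ i $ j)"
    by (simp add: hermitian_nth[OF assms(2)])
  have d: "Im (B $ r $ r) = 0" for r
    using hermitian_nth[OF assms(2), of r r] by (simp add: complex_eq_iff)
  have "(ctranspose (plane_rotation i j c s w) ** B ** plane_rotation i j c s w) $ l $ l
    = (\<Sum>r\<in>UNIV. cnj (plane_rotation i j c s w $ r $ l) * (\<Sum>q\<in>UNIV. plane_rotation i j c s w $ q $ l * B $ r $ q))"
    unfolding matrix_mul_assoc[symmetric] unfolding matrix_matrix_mult_def ctranspose_def
    by (simp add: mult.commute)
  also have "\<dots> = (if l = i then of_real c * (of_real c * B $ i $ i + of_real s * w * B $ i $ j)
        + of_real s * cnj w * (of_real c * B $ j $ i + of_real s * w * B $ j $ j)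
     else if l = j then - of_real s * w * (- of_real s * cnj w * B $ i $ i + of_real c * B $ i $ j)
         + of_real c * (- of_real s * cnj w * B $ j $ i + of_real c * B $ j $ j)
     else B $ l $ l)"
    unfolding sum_plane_rotation[OF assms(1)] sum_cnj_plane_rotation[OF assms(1)]
    using assms(1) by simp
  finally have eq:
    "(ctranspose (plane_rotation i j c s w) ** B ** plane_rotation i j c s w) $ l $ l = \<dots>" .
  consider "l = i" | "l = j" "l \<noteq> i" | "l \<noteq> i" "l \<noteq> j" by blast
  then show ?thesis
  proof cases
    case 1
    have "Re (of_real c * (of_real c * p + of_real s * w * b)
        + of_real s * cnj w * (of_real c * cnj b + of_real s * w * q))
      = c\<^sup>2 * Re p + s\<^sup>2 * (Re w * Re w + Im w * Im w) * Re q + 2 * c * s * Re (w * b)"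
      if "Im p = 0" "Im q = 0" for p q b
      using that by (simp add: power2_eq_square algebra_simps)
    from this[OF d d, of i "B $ i $ j" j] show ?thesis
      unfolding eq using 1 by (simp only: Bji if_True w mult_1_right refl)
  next
    case 2
    have "Re (- of_real s * w * (- of_real s * cnj w * p + of_real c * b)
         + of_real c * (- of_real s * cnj w * cnj b + of_real c * q))
      = s\<^sup>2 * (Re w * Re w + Im w * Im w) * Re p + c\<^sup>2 * Re q - 2 * c * s * Re (w * b)"
      if "Im p = 0" "Im q = 0" for p q b
      using that by (simp add: power2_eq_square algebra_simps)
    from this[OF d d, of i "B $ i $ j" j] show ?thesis
      unfolding eq using 2 by (simp only: Bji if_True if_False w mult_1_right refl)
  next
    case 3
    then show ?thesis unfolding eq by (simp only: if_False)
  qed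
qed

text \<open>Maximize \<open>\<Sum> c\<^sub>i (U\<^sup>H A U)\<^sub>i\<^sub>i\<close> with distinct weights over all unitary \<open>U\<close>; rotations
  in a coordinate plane show that the maximizer diagonalizes \<open>A\<close>.\<close>

theorem hermitian_diagonalization:
  fixes A :: "('n::finite,'n) cmat"
  assumes "hermitian A"
  obtains U :: "('n,'n) cmat" and d where "unitary U" "A = U ** diag (\<lambda>i. of_real (d i)) ** ctranspose U"
proof -
  obtain f :: "'n \<Rightarrow> nat" where "inj f"
    using finite_imp_inj_to_nat_seg[OF finite_class.finite_UNIV] by auto
  define c where "c i = real (f i)" for i
  have c: "c i \<noteq> c j" if "i \<noteq> j" for i j
    using that \<open>inj f\<close> by (auto simp: c_def inj_def)
  define g where "g U = (\<Sum>i\<in>UNIV. c i * Re ((ctranspose U ** A ** U) $ i $ i))" for U :: "('n,'n) cmat"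
  have "continuous_on stiefel g"
    unfolding g_def by (intro continuous_intros)
  moreover have "mat 1 \<in> (stiefel :: ('n,'n) cmat set)" by (simp add: stiefel_def)
  ultimately obtain U where U: "U \<in> stiefel" and max: "\<And>W. W \<in> stiefel \<Longrightarrow> g W \<le> g U"
    using continuous_attains_sup[OF compact_stiefel, of g] by blast
  have unit: "unitary U" using U by (simp add: stiefel_def unitaryI_left)
  define B where "B = ctranspose U ** A ** U"
  have herm: "hermitian B"
    using assms by (simp add: B_def hermitian_def matrix_mul_assoc)
  have off: "B $ i $ j = 0" if "i \<noteq> j" for i j
  proof (rule ccontr)
    assume nz: "B $ i $ j \<noteq> 0"
    \<comment> \<open>This phase makes w B_ij real with the sign of c_i - c_j, so the first-order
      change of the objective is the positive number 2 s h.\<close>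
    define w where "w = of_real (sgn (c i - c j)) * cnj (B $ i $ j) / of_real (cmod (B $ i $ j))"
    define h where "h = \<bar>c i - c j\<bar> * cmod (B $ i $ j)"
    have w1: "cmod w = 1"
      using nz c[OF that] by (simp add: w_def norm_mult norm_divide sgn_if)
    have "w * B $ i $ j = of_real (sgn (c i - c j) * cmod (B $ i $ j))"
    proof -
      have "w * B $ i $ j = of_real (sgn (c i - c j)) * (B $ i $ j * cnj (B $ i $ j)) / of_real (cmod (B $ i $ j))"
        by (simp add: w_def mult_ac)
      then show ?thesis
        using nz by (simp add: power2_eq_square flip: complex_norm_square)
    qed
    then have wB: "(c i - c j) * Re (w * B $ i $ j) = h"
      by (simp add: h_def sgn_if)
    have h: "h > 0" using nz c[OF that] by (simp add: h_def)
    define m where "m = (c i - c j) * (Re (B $ j $ j) - Re (B $ i $ i))"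
    \<comment> \<open>Maximality of U tested against U times a rotation: 2 x y h is the gain from
      the off-diagonal entry, y^2 m the change from mixing the two diagonal entries.\<close>
    have key: "2 * x * y * h + y\<^sup>2 * m \<le> 0" if xy: "x\<^sup>2 + y\<^sup>2 = 1" for x y
    proof -
      let ?R = "plane_rotation i j x y w"
      have R: "?R \<in> stiefel" by (rule plane_rotation_stiefel) fact+
      then have "unitary ?R" by (simp add: stiefel_def unitaryI_left)
      then have "g (U ** ?R) \<le> g U" using max stiefel_mult_unitary[OF U] by blast
      moreover have "ctranspose (U ** ?R) ** A ** (U ** ?R) = ctranspose ?R ** B ** ?R"
        by (simp add: B_def matrix_mul_assoc)
      ultimately have "(\<Sum>l\<in>UNIV. c l * (Re ((ctranspose ?R ** B ** ?R) $ l $ l) - Re (B $ l $ l))) \<le> 0"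
        by (simp add: g_def B_def right_diff_distrib sum_subtractf)
      also have "(\<Sum>l\<in>UNIV. c l * (Re ((ctranspose ?R ** B ** ?R) $ l $ l) - Re (B $ l $ l)))
        = (\<Sum>l\<in>{i,j}. c l * (Re ((ctranspose ?R ** B ** ?R) $ l $ l) - Re (B $ l $ l)))"
        by (rule sum.mono_neutral_right) (auto simp: plane_rotation_conj_diag[OF \<open>i \<noteq> j\<close> herm w1])
      also have "\<dots> = c i * (x\<^sup>2 * Re (B $ i $ i) + y\<^sup>2 * Re (B $ j $ j) + 2 * x * y * Re (w * B $ i $ j) - Re (B $ i $ i))
        + c j * (y\<^sup>2 * Re (B $ i $ i) + x\<^sup>2 * Re (B $ j $ j) - 2 * x * y * Re (w * B $ i $ j) - Re (B $ j $ j))"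
        using \<open>i \<noteq> j\<close> by (simp add: plane_rotation_conj_diag[OF \<open>i \<noteq> j\<close> herm w1] del: times_complex.simps)
      also have "\<dots> = 2 * x * y * ((c i - c j) * Re (w * B $ i $ j)) + y\<^sup>2 * m"
      proof -
        have x2: "x\<^sup>2 = 1 - y\<^sup>2" using xy by simp
        show ?thesis unfolding x2 m_def by (simp add: algebra_simps del: times_complex.simps)
      qed
      finally show ?thesis by (simp add: wB del: times_complex.simps)
    qed
    \<comment> \<open>The rotation with tangent t, normalized by sqrt (1 + t^2); a factor t is then
      cancelled.\<close>
    have lin: "2 * h + t * m \<le> 0" if t: "t > 0" for t
    proof -
      let ?r = "sqrt (1 + t\<^sup>2)"
      have r: "?r > 0" "?r\<^sup>2 = 1 + t\<^sup>2" by (simp_all add: add_pos_nonneg)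
      have "2 * (1 / ?r) * (t / ?r) * h + (t / ?r)\<^sup>2 * m \<le> 0"
        by (rule key) (use r in \<open>simp add: power_divide add_divide_distrib[symmetric]\<close>)
      moreover have "2 * (1 / ?r) * (t / ?r) * h + (t / ?r)\<^sup>2 * m = t * (2 * h + t * m) / ?r\<^sup>2"
        by (simp add: power2_eq_square algebra_simps add_divide_distrib)
      ultimately have "t * (2 * h + t * m) \<le> 0"
        using r by (metis divide_le_0_iff not_less zero_less_power)
      then show ?thesis using t by (simp add: mult_le_0_iff)
    qed
    \<comment> \<open>With this t the term t m is at least -h, so 2 h + t m is at least h > 0,
      contradicting \<open>lin\<close>. The summand 1 covers m = 0.\<close>
    have "h / (\<bar>m\<bar> + 1) * m \<ge> - h"
      using h by (simp add: field_simps) (smt (verit, best) mult_minus_right mult_left_mono)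
    with lin[of "h / (\<bar>m\<bar> + 1)"] h show False by simp
  qed
  have "B = diag (\<lambda>i. of_real (Re (B $ i $ i)))"
  proof -
    have "Im (B $ i $ i) = 0" for i
      using hermitian_nth[OF herm, of i i] by (simp add: complex_eq_iff)
    then show ?thesis using off by (auto simp: vec_eq_iff diag_def complex_eq_iff)
  qed
  moreover have "A = U ** B ** ctranspose U"
    using unit unfolding B_def unitary_def
    by (metis matrix_mul_assoc matrix_mul_lid matrix_mul_rid)
  ultimately show thesis using that[OF unit] by metis
qed

section \<open>Characteristic polynomials and ordered eigenvalues\<close>

lemma charpoly_diagonalizable:
  fixes U :: "('n::finite,'n) cmat"
  assumes "unitary U"
  shows "charpoly (U ** diag d ** ctranspose U) = (\<Prod>i\<in>UNIV. [:- d i, 1:])"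
proof -
  \<comment> \<open>Lifting to constant polynomials is a ring homomorphism on matrices, so x I - A
    factors as U (x I - D) U^H over the polynomial ring and multiplicativity of the determinant
    applies there.\<close>
  define pm :: "('n,'n) cmat \<Rightarrow> complex poly^'n^'n" where "pm A = (\<chi> i j. [:A $ i $ j:])" for A
  have pm_mult: "pm (A ** B) = pm A ** pm B" for A B
  proof -
    have const_sum: "[:sum f S:] = (\<Sum>l\<in>S. [:f l:])" for f :: "'n \<Rightarrow> complex" and S
    proof (induction S rule: infinite_finite_induct)
      case (insert x F)
      have "[:f x + sum f F:] = [:f x:] + [:sum f F:]" by simp
      then show ?case using insert by simp
    qed simp_all
    show ?thesis
      by (simp add: pm_def vec_eq_iff matrix_matrix_mult_def const_sum mult.commute)
  qed
  have pm1: "pm (mat 1) = mat 1"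
    by (simp add: pm_def vec_eq_iff mat_def one_pCons)
  define D :: "complex poly^'n^'n" where "D = (\<chi> i j. if i = j then [:- d i, 1:] else 0)"
  have "(\<chi> i j. (if i = j then [:0, 1:] else 0) - [:(U ** diag d ** ctranspose U) $ i $ j:])
      = mat [:0,1:] - pm (U ** diag d ** ctranspose U)"
    by (simp add: vec_eq_iff mat_def pm_def)
  also have "mat [:0,1:] = pm U ** mat [:0,1:] ** pm (ctranspose U)"
  proof -
    have "pm U ** mat [:0,1:] ** pm (ctranspose U) = mat [:0,1:] ** (pm U ** pm (ctranspose U))"
      by (simp add: vec_eq_iff matrix_matrix_mult_def mat_def if_distrib if_distribR sum_distrib_left
          mult_ac cong: if_cong)
    then show ?thesis using assms by (simp add: unitary_def pm1 flip: pm_mult)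
  qed
  also have "pm U ** mat [:0,1:] ** pm (ctranspose U) - pm (U ** diag d ** ctranspose U)
      = pm U ** D ** pm (ctranspose U)"
  proof -
    have "D = mat [:0,1:] - pm (diag d)"
      by (auto simp: D_def vec_eq_iff mat_def pm_def diag_def)
    moreover have "P ** (M - N) ** R = P ** M ** R - P ** N ** R" for P M N R :: "complex poly^'n^'n"
      by (simp add: vec_eq_iff matrix_matrix_mult_def algebra_simps sum_subtractf)
    ultimately show ?thesis by (simp add: pm_mult)
  qed
  finally have "charpoly (U ** diag d ** ctranspose U) = det (pm U) * det D * det (pm (ctranspose U))"
    by (simp add: charpoly_def det_mul)
  also have "\<dots> = det (pm U ** pm (ctranspose U)) * det D"
    by (simp add: det_mul mult_ac)
  also have "\<dots> = det D"
    using assms by (simp add: unitary_def pm1 flip: pm_mult)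
  also have "\<dots> = (\<Prod>i\<in>UNIV. [:- d i, 1:])"
    by (subst det_diagonal) (auto simp: D_def)
  finally show ?thesis .
qed

lemma eigenvalues_diagonalizable:
  fixes U :: "('n::finite,'n) cmat"
  assumes "unitary U"
  shows "eigenvalues (U ** diag d ** ctranspose U) = image_mset d (mset_set UNIV)"
proof -
  have "proots (\<Prod>i\<in>S. [:- d i, 1:]) = image_mset d (mset_set S)" if "finite S" for S :: "'n set"
    using that
  proof (induction S rule: finite_induct)
    case (insert x S)
    have "(\<Prod>i\<in>S. [:- d i, 1:]) \<noteq> 0"
      using insert by (auto simp: prod_zero_iff)
    then show ?case using insert by (simp add: proots_mult del: mult_pCons_left mult_pCons_right)
  qed simp
  then show ?thesis
    by (simp add: eigenvalues_def charpoly_diagonalizable[OF assms])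
qed

lemma trace_hermitian:
  fixes A :: "('n::finite,'n) cmat"
  assumes "hermitian A"
  shows "trace A = sum_mset (eigenvalues A)"
proof -
  obtain U :: "('n,'n) cmat" and d where U: "unitary U" "A = U ** diag (\<lambda>i. of_real (d i)) ** ctranspose U"
    using hermitian_diagonalization[OF assms] .
  have "trace A = trace (diag (\<lambda>i. of_real (d i)) ** (ctranspose U ** U))"
    unfolding U(2) by (metis matrix_mul_assoc trace_mul_sym)
  then show ?thesis
    unfolding U(2) eigenvalues_diagonalizable[OF U(1)] using U(1)
    by (simp add: unitary_def trace_def diag_def sum_unfold_sum_mset)
qed

lemma ascending_eigenvalues_diagonalizable:
  fixes U :: "('n::finite,'n) cmat"
  assumes "unitary U"
  shows "mset (ascending_eigenvalues (U ** diag (\<lambda>i. of_real (d i)) ** ctranspose U))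
    = image_mset d (mset_set UNIV)"
  by (simp add: ascending_eigenvalues_def eigenvalues_diagonalizable[OF assms] image_mset.compositionality o_def)

lemma sorted_ascending_eigenvalues: "sorted (ascending_eigenvalues A)"
  by (simp add: ascending_eigenvalues_def)

lemma length_ascending_eigenvalues:
  fixes A :: "('n::finite,'n) cmat"
  assumes "hermitian A"
  shows "length (ascending_eigenvalues A) = CARD('n)"
proof -
  obtain U :: "('n,'n) cmat" and d where U: "unitary U" "A = U ** diag (\<lambda>i. of_real (d i)) ** ctranspose U"
    using hermitian_diagonalization[OF assms] .
  have "size (mset (ascending_eigenvalues A)) = CARD('n)"
    unfolding U(2) ascending_eigenvalues_diagonalizable[OF U(1)] by simp
  then show ?thesis by simp
qed

lemma lam_mono:
  fixes A :: "('n::finite,'n) cmat"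
  assumes "hermitian A" "1 \<le> i" "i \<le> j" "j \<le> CARD('n)"
  shows "lam i A \<le> lam j A"
  unfolding lam_def using assms length_ascending_eigenvalues[OF assms(1)]
  by (intro sorted_nth_mono sorted_ascending_eigenvalues) auto

section \<open>Trace minimization\<close>

text \<open>V V^H is an orthogonal projection P, hence P_ii = sum_l |P_il|^2 is at least P_ii^2, and
  P_ii is the squared norm of row i of V.\<close>

lemma stiefel_row_le_1:
  assumes "V \<in> stiefel"
  shows "(\<Sum>j\<in>UNIV. (cmod (V $ i $ j))\<^sup>2) \<le> 1"
proof -
  define P where "P = V ** ctranspose V"
  have "P ** ctranspose P = V ** (ctranspose V ** V) ** ctranspose V"
    by (simp add: P_def matrix_mul_assoc)
  then have PP: "P ** ctranspose P = P"
    by (simp add: stiefelD[OF assms] P_def)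
  define w where "w = (\<Sum>j\<in>UNIV. (cmod (V $ i $ j))\<^sup>2)"
  have w: "P $ i $ i = of_real w"
    by (simp add: P_def matrix_matrix_mult_def w_def flip: complex_norm_square)
  have "of_real w = (P ** ctranspose P) $ i $ i" by (simp add: PP w)
  also have "\<dots> = of_real (\<Sum>l\<in>UNIV. (cmod (P $ i $ l))\<^sup>2)"
    by (simp add: matrix_matrix_mult_def flip: complex_norm_square)
  finally have "w = (\<Sum>l\<in>UNIV. (cmod (P $ i $ l))\<^sup>2)"
    by (simp only: of_real_eq_iff)
  also have "\<dots> \<ge> (cmod (P $ i $ i))\<^sup>2"
    by (rule member_le_sum) auto
  finally have "w * w \<le> w" by (simp add: w power2_eq_square)
  then have "\<not> 1 < w" using mult_strict_right_mono[of 1 w w] by auto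
  then show ?thesis by (simp add: w_def)
qed

lemma trace_diag_conj:
  fixes X :: "('n::finite,'k::finite) cmat"
  shows "trace (ctranspose X ** diag (\<lambda>i. of_real (d i)) ** X)
    = of_real (\<Sum>i\<in>UNIV. d i * (\<Sum>j\<in>UNIV. (cmod (X $ i $ j))\<^sup>2))"
proof -
  have "trace (ctranspose X ** (diag (\<lambda>i. of_real (d i)) ** X))
    = (\<Sum>j\<in>UNIV. \<Sum>i\<in>UNIV. of_real (d i) * (X $ i $ j * cnj (X $ i $ j)))"
    unfolding trace_def matrix_matrix_mult_def[of "ctranspose X"] by (simp add: mult_ac)
  also have "\<dots> = (\<Sum>i\<in>UNIV. of_real (d i) * (\<Sum>j\<in>UNIV. X $ i $ j * cnj (X $ i $ j)))"
    by (subst sum.swap) (simp add: sum_distrib_left)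
  finally show ?thesis by (simp add: matrix_mul_assoc flip: complex_norm_square)
qed

text \<open>The bathtub principle: with total mass k and at most one unit per place, nothing is
  cheaper than filling the k smallest values. Subtracting the threshold \<tau> reduces it to the
  pointwise inequality min (x - \<tau>) 0 \<le> (x - \<tau>) w for 0 \<le> w \<le> 1.\<close>

lemma sum_smallest_le_weighted_sum:
  fixes d w :: "'n::finite \<Rightarrow> real"
  assumes xs: "sorted xs" "mset xs = image_mset d (mset_set UNIV)"
    and w: "\<And>i. 0 \<le> w i" "\<And>i. w i \<le> 1" "sum w UNIV = real k"
  shows "sum_list (take k xs) \<le> (\<Sum>i\<in>UNIV. d i * w i)"
proof (cases "k = 0")
  case True
  then have "w i = 0" for i
    using w(1,3) by (simp add: sum_nonneg_eq_0_iff)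
  then show ?thesis using True by simp
next
  case False
  have len: "length xs = CARD('n)"
    using xs(2) by (metis size_image_mset size_mset size_mset_set)
  have "real k \<le> (\<Sum>i\<in>(UNIV::'n set). 1)"
    unfolding w(3)[symmetric] by (intro sum_mono w(2))
  then have kn: "k \<le> length xs" by (simp add: len)
  \<comment> \<open>The k-th smallest value, since lists are indexed from 0; this is why k = 0 is
    treated separately.\<close>
  define \<tau> where "\<tau> = xs ! (k - 1)"
  define f where "f x = min (x - \<tau>) 0" for x
  have take: "x \<le> \<tau>" if "x \<in> set (take k xs)" for x
    using that False kn xs(1) unfolding \<tau>_def
    by (auto simp: in_set_conv_nth intro!: sorted_nth_mono)
  have drop: "x \<ge> \<tau>" if "x \<in> set (drop k xs)" for x
    using that False kn xs(1) unfolding \<tau>_def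
    by (auto simp: in_set_conv_nth intro!: sorted_nth_mono)
  have "sum_list (map f xs) = sum_list (map f (take k xs)) + sum_list (map f (drop k xs))"
    by (metis append_take_drop_id map_append sum_list_append)
  also have "map f (take k xs) = map (\<lambda>x. x - \<tau>) (take k xs)"
    using take by (auto simp: f_def)
  also have "map f (drop k xs) = map (\<lambda>x. 0) (drop k xs)"
    using drop by (auto simp: f_def)
  also have "sum_list (map (\<lambda>x. x - \<tau>) (take k xs)) = sum_list (take k xs) - real k * \<tau>"
    using kn by (simp add: sum_list_subtractf sum_list_triv min_def)
  finally have "sum_list (take k xs) - real k * \<tau> = sum_list (map f xs)" by simp
  also have "\<dots> = sum_mset (image_mset f (mset xs))"
    by (metis mset_map sum_mset_sum_list)
  also have "\<dots> = (\<Sum>i\<in>UNIV. f (d i))"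
    by (simp add: xs(2) sum_unfold_sum_mset image_mset.compositionality o_def)
  also have "\<dots> \<le> (\<Sum>i\<in>UNIV. (d i - \<tau>) * w i)"
  proof (rule sum_mono)
    fix i
    show "f (d i) \<le> (d i - \<tau>) * w i"
    proof (cases "d i \<ge> \<tau>")
      case False
      then have "(d i - \<tau>) * 1 \<le> (d i - \<tau>) * w i"
        by (intro mult_left_mono_neg w(2)) simp
      then show ?thesis using False by (simp add: f_def)
    qed (simp add: f_def w(1))
  qed
  also have "\<dots> = (\<Sum>i\<in>UNIV. d i * w i) - real k * \<tau>"
    by (simp add: algebra_simps sum_subtractf sum_distrib_left flip: w(3))
  finally show ?thesis by simp
qed

text \<open>In eigencoordinates the trace is a weighted sum of eigenvalues whose weights are the
  squared row norms of U^H V. These are at most 1 and add up to k, so the bathtub principle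
  applies.\<close>

theorem Ky_Fan_le:
  fixes A :: "('n::finite,'n) cmat" and V :: "('n,'k::finite) cmat"
  assumes "hermitian A" "V \<in> stiefel"
  shows "sum_list (take CARD('k) (ascending_eigenvalues A)) \<le> Re (trace (ctranspose V ** A ** V))"
proof -
  obtain U :: "('n,'n) cmat" and d where U: "unitary U" "A = U ** diag (\<lambda>i. of_real (d i)) ** ctranspose U"
    using hermitian_diagonalization[OF assms(1)] .
  define X where "X = ctranspose U ** V"
  have "ctranspose X ** X = ctranspose V ** (U ** ctranspose U) ** V"
    by (simp add: X_def matrix_mul_assoc)
  then have X: "X \<in> stiefel"
    using U(1) stiefelD[OF assms(2)] by (simp add: unitary_def stiefel_def)
  have "sum_list (take CARD('k) (ascending_eigenvalues A))
      \<le> (\<Sum>i\<in>UNIV. d i * (\<Sum>j\<in>UNIV. (cmod (X $ i $ j))\<^sup>2))"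
  proof (rule sum_smallest_le_weighted_sum)
    show "mset (ascending_eigenvalues A) = image_mset d (mset_set UNIV)"
      unfolding U(2) by (rule ascending_eigenvalues_diagonalizable[OF U(1)])
    show "(\<Sum>i\<in>UNIV. \<Sum>j\<in>UNIV. (cmod (X $ i $ j))\<^sup>2) = real CARD('k)"
      using norm_stiefel_sq[OF X] by (simp add: norm_cmat_sq)
  qed (simp_all add: sorted_ascending_eigenvalues sum_nonneg stiefel_row_le_1[OF X])
  also have "\<dots> = Re (trace (ctranspose X ** diag (\<lambda>i. of_real (d i)) ** X))"
    by (simp only: trace_diag_conj Re_complex_of_real)
  also have "ctranspose X ** diag (\<lambda>i. of_real (d i)) ** X = ctranspose V ** A ** V"
    by (simp add: X_def U(2) matrix_mul_assoc)
  finally show ?thesis .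
qed

lemma hermitian_conj: "hermitian A \<Longrightarrow> hermitian (ctranspose V ** A ** V)"
  by (simp add: hermitian_def matrix_mul_assoc)

text \<open>What the convergence proof keeps of an SCF step: invariance yields the Sylvester
  equation, minimality the a priori bound. Both survive V -> V Q, and neither refers to a choice of
  eigenvectors.\<close>

definition trace_minimizer :: "('n::finite, 'n) cmat \<Rightarrow> ('n, 'k::finite) cmat \<Rightarrow> bool" where
  "trace_minimizer A V \<longleftrightarrow> V \<in> stiefel \<and> A ** V = V ** (ctranspose V ** A ** V) \<and>
     (\<forall>W \<in> (stiefel :: ('n,'k) cmat set).
        Re (trace (ctranspose V ** A ** V)) \<le> Re (trace (ctranspose W ** A ** W)))"

text \<open>The matrix L in A V = V L must be V^H A V. It is Hermitian, so its trace is the sum of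
  its eigenvalues, which is exactly the Ky Fan lower bound.\<close>

lemma smallest_eigenbasis_trace_minimizer:
  fixes A :: "('n::finite,'n) cmat" and V :: "('n,'k::finite) cmat"
  assumes "hermitian A" "smallest_eigenbasis A V"
  shows "trace_minimizer A V"
proof -
  obtain L :: "('k,'k) cmat" where V: "V \<in> stiefel" and L: "A ** V = V ** L"
    "eigenvalues L = mset (map of_real (take CARD('k) (ascending_eigenvalues A)))"
    using assms(2) by (auto simp: smallest_eigenbasis_def)
  have "ctranspose V ** A ** V = (ctranspose V ** V) ** L"
    by (metis L(1) matrix_mul_assoc)
  then have LV: "L = ctranspose V ** A ** V" by (simp add: stiefelD[OF V])
  have "trace L = sum_mset (eigenvalues L)"
    by (rule trace_hermitian) (simp add: LV hermitian_conj assms(1))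
  also have "\<dots> = of_real (sum_list (take CARD('k) (ascending_eigenvalues A)))"
  proof -
    have "sum_mset (mset (map of_real xs)) = complex_of_real (sum_list xs)" for xs
      by (induction xs) simp_all
    then show ?thesis by (simp only: L(2))
  qed
  finally have "Re (trace L) = sum_list (take CARD('k) (ascending_eigenvalues A))" by simp
  then show ?thesis
    using V L(1) Ky_Fan_le[OF assms(1), where ?'k = 'k] by (simp add: trace_minimizer_def LV)
qed

lemma trace_minimizer_mult_unitary:
  fixes V :: "('n::finite,'k::finite) cmat" and Q :: "('k,'k) cmat"
  assumes "trace_minimizer A V" "unitary Q" shows "trace_minimizer A (V ** Q)"
proof -
  have Q: "Q ** ctranspose Q = mat 1" using assms(2) by (simp add: unitary_def)
  have conj: "ctranspose (V ** Q) ** A ** (V ** Q) = ctranspose Q ** ((ctranspose V ** A ** V) ** Q)"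
    by (simp add: matrix_mul_assoc)
  have "trace (ctranspose (V ** Q) ** A ** (V ** Q)) = trace (ctranspose V ** A ** V)"
    unfolding conj using Q by (metis matrix_mul_assoc matrix_mul_rid trace_mul_sym)
  moreover have "A ** (V ** Q) = (V ** Q) ** (ctranspose (V ** Q) ** A ** (V ** Q))"
  proof -
    have "(V ** Q) ** (ctranspose (V ** Q) ** A ** (V ** Q))
        = V ** (Q ** ctranspose Q) ** (ctranspose V ** A ** V) ** Q"
      by (simp add: matrix_mul_assoc)
    then show ?thesis
      using assms(1) Q by (simp add: trace_minimizer_def matrix_mul_assoc)
  qed
  ultimately show ?thesis
    using assms by (simp add: trace_minimizer_def stiefel_mult_unitary del: ctranspose_mult)
qed

section \<open>Orthogonal splittings\<close>

locale unitary_split =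
  fixes Vs :: "('n::finite,'k::finite) cmat" and Vp :: "('n,'m::finite) cmat"
  assumes unitary_hcat: "unitary (hcat Vs Vp)"
begin

lemma Vs_Vs: "ctranspose Vs ** Vs = mat 1"
  and Vp_Vp: "ctranspose Vp ** Vp = mat 1"
  and Vs_Vp: "ctranspose Vs ** Vp = 0"
  and Vp_Vs: "ctranspose Vp ** Vs = 0"
  and resolution: "Vs ** ctranspose Vs + Vp ** ctranspose Vp = mat 1"
proof -
  have eq: "(ctranspose (hcat Vs Vp) ** hcat Vs Vp) $ a $ b = mat 1 $ a $ b" for a b
    using unitary_hcat by (simp add: unitary_def)
  show "ctranspose Vs ** Vs = mat 1"
    using eq[of "Inl i" "Inl j" for i j]
    by (simp add: vec_eq_iff matrix_matrix_mult_def hcat_def mat_def)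
  show "ctranspose Vp ** Vp = mat 1"
    using eq[of "Inr i" "Inr j" for i j]
    by (simp add: vec_eq_iff matrix_matrix_mult_def hcat_def mat_def)
  show "ctranspose Vs ** Vp = 0"
    using eq[of "Inl i" "Inr j" for i j]
    by (simp add: vec_eq_iff matrix_matrix_mult_def hcat_def mat_def)
  show "ctranspose Vp ** Vs = 0"
    using eq[of "Inr i" "Inl j" for i j]
    by (simp add: vec_eq_iff matrix_matrix_mult_def hcat_def mat_def)
  have "hcat Vs Vp ** ctranspose (hcat Vs Vp) = mat 1"
    using unitary_hcat by (simp add: unitary_def)
  moreover have "(\<Sum>s\<in>UNIV. g s) = (\<Sum>j\<in>UNIV. g (Inl j)) + (\<Sum>j\<in>UNIV. g (Inr j))"
    for g :: "'k + 'm \<Rightarrow> complex"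
    unfolding UNIV_Plus_UNIV[symmetric] by (subst sum.Plus) simp_all
  ultimately show "Vs ** ctranspose Vs + Vp ** ctranspose Vp = mat 1"
    by (simp add: vec_eq_iff matrix_matrix_mult_def hcat_def)
qed

lemma Vs_stiefel: "Vs \<in> stiefel" and Vp_stiefel: "Vp \<in> stiefel"
  by (simp_all add: stiefel_def Vs_Vs Vp_Vp)

lemma split: "W = Vs ** (ctranspose Vs ** W) + Vp ** (ctranspose Vp ** W)"
proof -
  have "Vs ** (ctranspose Vs ** W) + Vp ** (ctranspose Vp ** W)
      = (Vs ** ctranspose Vs + Vp ** ctranspose Vp) ** W"
    by (simp only: cmat_algebra)
  then show ?thesis by (simp add: resolution)
qed

lemma gram_split:
  "ctranspose W ** W = ctranspose (ctranspose Vs ** W) ** (ctranspose Vs ** W)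
     + ctranspose (ctranspose Vp ** W) ** (ctranspose Vp ** W)"
proof -
  have "ctranspose W ** (Vs ** ctranspose Vs + Vp ** ctranspose Vp) ** W
    = ctranspose (ctranspose Vs ** W) ** (ctranspose Vs ** W)
     + ctranspose (ctranspose Vp ** W) ** (ctranspose Vp ** W)"
    by (simp add: cmat_algebra)
  then show ?thesis by (simp add: resolution)
qed

lemma norm_split: "(norm W)\<^sup>2 = (norm (ctranspose Vs ** W))\<^sup>2 + (norm (ctranspose Vp ** W))\<^sup>2"
  using arg_cong[OF gram_split[of W], of "\<lambda>X. Re (trace X)"]
  by (simp add: power2_norm_eq_inner inner_cmat trace_add)

text \<open>These are rows of [Vs, Vp]^H W, which again has orthonormal columns.\<close>

lemma row_Vs_le_1:
  assumes "W \<in> stiefel"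
  shows "(\<Sum>j\<in>UNIV. (cmod ((ctranspose Vs ** W) $ i $ j))\<^sup>2) \<le> 1"
proof -
  have "ctranspose (ctranspose (hcat Vs Vp) ** W) ** (ctranspose (hcat Vs Vp) ** W)
      = ctranspose W ** (hcat Vs Vp ** ctranspose (hcat Vs Vp)) ** W"
    by (simp add: matrix_mul_assoc)
  then have "ctranspose (hcat Vs Vp) ** W \<in> stiefel"
    using unitary_hcat stiefelD[OF assms] by (simp add: unitary_def stiefel_def)
  from stiefel_row_le_1[OF this, of "Inl i"] show ?thesis
    by (simp add: matrix_matrix_mult_def hcat_def)
qed

text \<open>A mass balance. The rows of Vs^H W carry masses r_j \<le> 1, and the total mass missing
  there equals the mass |Vp^H W|^2 found in the complement. Each missing unit saves at most
  \<alpha>, each unit in the complement costs at least \<alpha> + \<gamma>.\<close>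

lemma trace_gap:
  fixes W :: "('n,'k) cmat"
  assumes W: "W \<in> stiefel"
    and A: "A ** Vs = Vs ** diag (\<lambda>j. of_real (a j))" "A ** Vp = Vp ** diag (\<lambda>i. of_real (b i))"
    and a: "\<And>j. a j \<le> \<alpha>" and b: "\<And>i. \<alpha> + \<gamma> \<le> b i"
  shows "\<gamma> * (norm (ctranspose Vp ** W))\<^sup>2
    \<le> Re (trace (ctranspose W ** A ** W)) - Re (trace (ctranspose Vs ** A ** Vs))"
proof -
  define C S where "C = ctranspose Vs ** W" and "S = ctranspose Vp ** W"
  define r where "r j = (\<Sum>l\<in>UNIV. (cmod (C $ j $ l))\<^sup>2)" for j
  define s where "s i = (\<Sum>l\<in>UNIV. (cmod (S $ i $ l))\<^sup>2)" for i
  let ?a = "diag (\<lambda>j. complex_of_real (a j))" and ?b = "diag (\<lambda>i. complex_of_real (b i))"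
  have AW: "A ** W = Vs ** ?a ** C + Vp ** ?b ** S"
    by (subst split[of W]) (simp add: C_def S_def matrix_add_ldistrib matrix_mul_assoc A)
  have "ctranspose W ** A ** W = ctranspose W ** (A ** W)" by (simp add: matrix_mul_assoc)
  also have "\<dots> = ctranspose C ** ?a ** C + ctranspose S ** ?b ** S"
    unfolding AW by (simp add: C_def S_def matrix_add_ldistrib matrix_mul_assoc)
  finally have "Re (trace (ctranspose W ** A ** W)) = (\<Sum>j\<in>UNIV. a j * r j) + (\<Sum>i\<in>UNIV. b i * s i)"
    by (simp add: trace_add trace_diag_conj r_def s_def del: of_real_sum of_real_mult)
  moreover have "Re (trace (ctranspose Vs ** A ** Vs)) = (\<Sum>j\<in>UNIV. a j)"
  proof -
    have "ctranspose Vs ** A ** Vs = ?a"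
      by (metis A(1) Vs_Vs matrix_mul_assoc matrix_mul_lid)
    then show ?thesis by (simp add: trace_def diag_def)
  qed
  moreover have total: "(\<Sum>j\<in>UNIV. r j) + (\<Sum>i\<in>UNIV. s i) = CARD('k)"
    using norm_split[of W] norm_stiefel_sq[OF W] by (simp add: norm_cmat_sq r_def s_def C_def S_def)
  moreover have "(\<Sum>j\<in>UNIV. a j) - (\<Sum>j\<in>UNIV. a j * r j) \<le> \<alpha> * (\<Sum>i\<in>UNIV. s i)"
  proof -
    have "(\<Sum>j\<in>UNIV. a j - a j * r j) \<le> (\<Sum>j\<in>UNIV. \<alpha> - \<alpha> * r j)"
    proof (rule sum_mono)
      fix j
      have "a j * (1 - r j) \<le> \<alpha> * (1 - r j)"
        using row_Vs_le_1[OF W, of j] by (intro mult_right_mono a) (simp add: r_def C_def)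
      then show "a j - a j * r j \<le> \<alpha> - \<alpha> * r j" by (simp add: algebra_simps)
    qed
    also have "\<dots> = \<alpha> * (CARD('k) - (\<Sum>j\<in>UNIV. r j))"
      by (simp add: sum_subtractf sum_distrib_left right_diff_distrib)
    also have "\<dots> = \<alpha> * (\<Sum>i\<in>UNIV. s i)"
      by (simp flip: total)
    finally show ?thesis by (simp add: sum_subtractf)
  qed
  moreover have "(\<Sum>i\<in>UNIV. (\<alpha> + \<gamma>) * s i) \<le> (\<Sum>i\<in>UNIV. b i * s i)"
    by (intro sum_mono mult_right_mono b) (simp add: s_def sum_nonneg)
  moreover have "(norm (ctranspose Vp ** W))\<^sup>2 = (\<Sum>i\<in>UNIV. s i)"
    by (simp add: norm_cmat_sq s_def S_def)
  ultimately show ?thesis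
    by (simp add: distrib_right sum.distrib flip: sum_distrib_left)
qed

end

section \<open>Self-adjoint operators\<close>

text \<open>With m the maximum of the quotient of the two forms, attained at x, the operator G = m T
  - K is positive semidefinite and its form vanishes at x. For a symmetric semidefinite operator
  this forces G x = 0.\<close>

lemma generalized_Rayleigh_maximizer:
  fixes K T :: "'a::euclidean_space \<Rightarrow> 'a"
  assumes lin: "linear K" "linear T"
    and sym: "\<And>x y. x \<bullet> K y = K x \<bullet> y" "\<And>x y. x \<bullet> T y = T x \<bullet> y"
    and pos: "\<And>x. x \<noteq> 0 \<Longrightarrow> x \<bullet> T x > 0"
  obtains m x where "x \<noteq> 0" "K x = m *\<^sub>R T x" "\<And>z. z \<bullet> K z \<le> m * (z \<bullet> T z)"
proof -
  have cont: "continuous_on (sphere 0 1) (\<lambda>x. (x \<bullet> K x) / (x \<bullet> T x))"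
  proof (intro continuous_intros linear_continuous_on)
    show "bounded_linear K" "bounded_linear T"
      using lin by (simp_all add: linear_conv_bounded_linear)
    show "\<forall>x\<in>sphere 0 1. x \<bullet> T x \<noteq> 0"
    proof
      fix x :: 'a assume "x \<in> sphere 0 1"
      then have "x \<noteq> 0" by auto
      then show "x \<bullet> T x \<noteq> 0" using pos by force
    qed
  qed
  have "(sphere 0 1 :: 'a set) \<noteq> {}" by simp
  then obtain x where x: "x \<in> sphere 0 1"
    and max: "\<And>y. y \<in> sphere 0 1 \<Longrightarrow> (y \<bullet> K y) / (y \<bullet> T y) \<le> (x \<bullet> K x) / (x \<bullet> T x)"
    using continuous_attains_sup[OF compact_sphere _ cont] by blast
  define m where "m = (x \<bullet> K x) / (x \<bullet> T x)"
  have x0: "x \<noteq> 0" using x by auto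
  have le: "z \<bullet> K z \<le> m * (z \<bullet> T z)" for z
  proof (cases "z = 0")
    case True
    then show ?thesis using linear_0[OF lin(1)] by simp
  next
    case False
    define y where "y = z /\<^sub>R norm z"
    have zy: "z = norm z *\<^sub>R y" and y: "y \<in> sphere 0 1" using False by (simp_all add: y_def)
    then have "y \<noteq> 0" by auto
    then have "y \<bullet> K y \<le> m * (y \<bullet> T y)"
      using max[OF y] pos[of y] by (simp add: m_def[symmetric] pos_divide_le_eq)
    then have "(norm z)\<^sup>2 * (y \<bullet> K y) \<le> (norm z)\<^sup>2 * (m * (y \<bullet> T y))"
      by (rule mult_left_mono) simp
    then show ?thesis
      by (subst (1 2 3 4) zy) (simp add: linear_scale[OF lin(1)] linear_scale[OF lin(2)] power2_eq_square mult_ac)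
  qed
  define G where "G z = m *\<^sub>R T z - K z" for z
  have Gx: "x \<bullet> G x = 0"
    using pos[OF x0] by (simp add: G_def m_def inner_diff_right)
  \<comment> \<open>Semidefiniteness tested at x - t G x: the constant term vanishes, so a linear
    term in t is bounded by a quadratic one.\<close>
  have key: "2 * t * (G x \<bullet> G x) \<le> t\<^sup>2 * (G x \<bullet> G (G x))" for t
  proof -
    define y where "y = G x"
    have "0 \<le> (x - t *\<^sub>R y) \<bullet> G (x - t *\<^sub>R y)"
      using le[of "x - t *\<^sub>R y"] by (simp add: G_def inner_diff_right)
    also have "G (x - t *\<^sub>R y) = G x - t *\<^sub>R G y"
      by (simp add: G_def linear_diff[OF lin(1)] linear_diff[OF lin(2)] linear_scale[OF lin(1)] linear_scale[OF lin(2)] algebra_simps)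
    also have "(x - t *\<^sub>R y) \<bullet> (G x - t *\<^sub>R G y) = - t * (y \<bullet> G x) - t * (x \<bullet> G y) + t\<^sup>2 * (y \<bullet> G y)"
      by (simp add: Gx inner_diff_left inner_diff_right power2_eq_square algebra_simps)
    also have "x \<bullet> G y = G x \<bullet> y"
      by (simp add: G_def inner_diff_left inner_diff_right sym)
    finally show ?thesis by (simp add: y_def inner_commute)
  qed
  have "G x \<bullet> G x \<le> 0"
  proof (rule ccontr)
    assume "\<not> G x \<bullet> G x \<le> 0"
    then have p: "G x \<bullet> G x > 0" by (simp only: not_le)
    \<comment> \<open>A positive number strictly above the quadratic coefficient; taking t = |G x|^2
      / c in \<open>key\<close> turns the inequality into |G x|^4 \<le> 0.\<close>
    define c where "c = \<bar>G x \<bullet> G (G x)\<bar> + 1"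
    have c: "c > 0" "G x \<bullet> G (G x) < c" by (simp_all add: c_def)
    have "2 * (p / c) * p \<le> (p / c)\<^sup>2 * (G x \<bullet> G (G x))" if "p = G x \<bullet> G x" for p
      using key[of "p / c"] that by simp
    also have "(p / c)\<^sup>2 * (G x \<bullet> G (G x)) \<le> (p / c)\<^sup>2 * c" for p
      using c by (intro mult_left_mono) auto
    finally have "2 * ((G x \<bullet> G x) / c) * (G x \<bullet> G x) \<le> ((G x \<bullet> G x) / c)\<^sup>2 * c" by blast
    then have "(G x \<bullet> G x) * (G x \<bullet> G x) \<le> 0" using c by (simp add: power2_eq_square field_simps)
    then show False using mult_pos_pos[OF p p] by linarith
  qed
  then have "G x = 0" by (metis inner_gt_zero_iff not_le)
  then show thesis using that[OF x0 _ le] by (simp add: G_def)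
qed

text \<open>Write the coordinate vector of an eigenvector as that of x + i y with x and y in the
  real space, and compare real and imaginary parts. This removes coordinates from all later spectral
  arguments.\<close>

lemma op_eigenvalue_iff:
  fixes L :: "'a::euclidean_space \<Rightarrow> 'a"
  assumes "linear L"
  shows "op_eigenvalue L \<mu> \<longleftrightarrow> (\<exists>x y. (x \<noteq> 0 \<or> y \<noteq> 0) \<and>
    L x = Re \<mu> *\<^sub>R x - Im \<mu> *\<^sub>R y \<and> L y = Im \<mu> *\<^sub>R x + Re \<mu> *\<^sub>R y)"
proof -
  have expand: "(\<Sum>c\<in>Basis. of_real (real_matrix L b c) * v c)
      = Complex (b \<bullet> L (\<Sum>c\<in>Basis. Re (v c) *\<^sub>R c)) (b \<bullet> L (\<Sum>c\<in>Basis. Im (v c) *\<^sub>R c))" for v b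
    by (simp add: complex_eq_iff linear_sum[OF assms] linear_scale[OF assms] inner_sum_right
        real_matrix_def mult.commute)
  show ?thesis
  proof
    assume "op_eigenvalue L \<mu>"
    then obtain v where nz: "\<exists>b\<in>Basis. v b \<noteq> 0"
      and ev: "\<And>b. b \<in> Basis \<Longrightarrow> (\<Sum>c\<in>Basis. of_real (real_matrix L b c) * v c) = \<mu> * v b"
      by (auto simp: op_eigenvalue_def)
    define x y where "x = (\<Sum>c\<in>Basis. Re (v c) *\<^sub>R c)" and "y = (\<Sum>c\<in>Basis. Im (v c) *\<^sub>R c)"
    have comp: "x \<bullet> b = Re (v b)" "y \<bullet> b = Im (v b)" if "b \<in> Basis" for b
      using that by (simp_all add: x_def y_def)
    have "x \<noteq> 0 \<or> y \<noteq> 0"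
      using nz comp by (metis complex_eqI inner_zero_left zero_complex.sel)
    moreover have "L x \<bullet> b = (Re \<mu> *\<^sub>R x - Im \<mu> *\<^sub>R y) \<bullet> b" "L y \<bullet> b = (Im \<mu> *\<^sub>R x + Re \<mu> *\<^sub>R y) \<bullet> b"
      if b: "b \<in> Basis" for b
      using ev[OF b] unfolding expand x_def[symmetric] y_def[symmetric]
      by (simp_all add: complex_eq_iff comp[OF b] inner_diff_left inner_add_left inner_commute[of b] algebra_simps)
    ultimately show "\<exists>x y. (x \<noteq> 0 \<or> y \<noteq> 0) \<and>
      L x = Re \<mu> *\<^sub>R x - Im \<mu> *\<^sub>R y \<and> L y = Im \<mu> *\<^sub>R x + Re \<mu> *\<^sub>R y"
      by (metis euclidean_eqI)
  next
    assume "\<exists>x y. (x \<noteq> 0 \<or> y \<noteq> 0) \<and>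
      L x = Re \<mu> *\<^sub>R x - Im \<mu> *\<^sub>R y \<and> L y = Im \<mu> *\<^sub>R x + Re \<mu> *\<^sub>R y"
    then obtain x y where nz: "x \<noteq> 0 \<or> y \<noteq> 0"
      and xy: "L x = Re \<mu> *\<^sub>R x - Im \<mu> *\<^sub>R y" "L y = Im \<mu> *\<^sub>R x + Re \<mu> *\<^sub>R y" by blast
    define v where "v b = Complex (x \<bullet> b) (y \<bullet> b)" for b
    have "\<exists>b\<in>Basis. v b \<noteq> 0"
      using nz by (simp add: v_def complex_eq_iff) (metis euclidean_all_zero_iff)
    moreover have "(\<Sum>c\<in>Basis. of_real (real_matrix L b c) * v c) = \<mu> * v b" for b
      unfolding expand
      by (simp add: v_def euclidean_representation xy complex_eq_iff inner_diff_right inner_add_right inner_commute[of b])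
    ultimately show "op_eigenvalue L \<mu>" unfolding op_eigenvalue_def by blast
  qed
qed

text \<open>L is self-adjoint for the inner product of x and T y. It is instantiated with T the
  identity for the operator Q, with T the entrywise weights for the iteration operator, and with L
  replaced by its negative to treat smallest eigenvalues.\<close>

locale weighted_self_adjoint =
  fixes T L :: "'a::euclidean_space \<Rightarrow> 'a"
  assumes linear_T: "linear T" and linear_L: "linear L"
    and T_sym: "\<And>x y. x \<bullet> T y = T x \<bullet> y"
    and T_pos: "\<And>x. x \<noteq> 0 \<Longrightarrow> x \<bullet> T x > 0"
    and TL_sym: "\<And>x y. x \<bullet> T (L y) = T (L x) \<bullet> y"
begin

lemmas T_simps = linear_add[OF linear_T] linear_diff[OF linear_T] linear_scale[OF linear_T] linear_neg[OF linear_T]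
lemmas L_simps = linear_add[OF linear_L] linear_diff[OF linear_L]

lemma T_eq_0_iff: "T x = 0 \<longleftrightarrow> x = 0"
  using T_pos[of x] linear_0[OF linear_T] by force

lemma T_nonneg: "x \<bullet> T x \<ge> 0"
  using T_pos[of x] by (cases "x = 0") auto

lemma op_eigenvalueI: "x \<noteq> 0 \<Longrightarrow> L x = m *\<^sub>R x \<Longrightarrow> op_eigenvalue L (of_real m)"
  unfolding op_eigenvalue_iff[OF linear_L] using linear_0[OF linear_L] by (intro exI[of _ x] exI[of _ 0]) simp

text \<open>Pairing x with L y in the two possible ways makes the terms with Re \<mu> cancel and
  leaves Im \<mu> times the sum of the weighted squared norms of x and y, which is positive.\<close>

lemma op_eigenvalue_real:
  assumes "op_eigenvalue L \<mu>"
  obtains m x where "\<mu> = of_real m" "x \<noteq> 0" "L x = m *\<^sub>R x"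
proof -
  obtain x y where nz: "x \<noteq> 0 \<or> y \<noteq> 0"
    and x: "L x = Re \<mu> *\<^sub>R x - Im \<mu> *\<^sub>R y" and y: "L y = Im \<mu> *\<^sub>R x + Re \<mu> *\<^sub>R y"
    using assms unfolding op_eigenvalue_iff[OF linear_L] by blast
  have "x \<bullet> T (L y) = Im \<mu> * (x \<bullet> T x) + Re \<mu> * (x \<bullet> T y)"
    by (simp add: y T_simps inner_add_right)
  moreover have "T (L x) \<bullet> y = Re \<mu> * (T x \<bullet> y) - Im \<mu> * (T y \<bullet> y)"
    by (simp add: x T_simps inner_diff_left)
  ultimately have "Im \<mu> * (x \<bullet> T x + y \<bullet> T y) = 0"
    using TL_sym[of x y] T_sym[of x y] inner_commute[of "T y" y] by (simp add: distrib_left)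
  moreover have "x \<bullet> T x + y \<bullet> T y > 0"
    using nz T_pos T_nonneg by (metis add_nonneg_pos add_pos_nonneg)
  ultimately have im: "Im \<mu> = 0" by auto
  then have "\<mu> = of_real (Re \<mu>)" by (simp add: complex_eq_iff)
  with im nz x y that[of "Re \<mu>"] show thesis by auto
qed

text \<open>Eigenvectors for different eigenvalues are orthogonal in the weighted inner product,
  hence linearly independent. Finiteness is what gives \<open>Max\<close> and \<open>Min\<close> in
  the spectral definitions their meaning.\<close>

lemma finite_op_eigenvalues: "finite {\<mu>. op_eigenvalue L \<mu>}"
proof -
  define E where "E = {m. \<exists>x. x \<noteq> 0 \<and> L x = m *\<^sub>R x}"
  define f where "f m = (SOME x. x \<noteq> 0 \<and> L x = m *\<^sub>R x)" for m
  have f: "f m \<noteq> 0" "L (f m) = m *\<^sub>R f m" if "m \<in> E" for m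
    using someI_ex[of "\<lambda>x. x \<noteq> 0 \<and> L x = m *\<^sub>R x"] that by (auto simp: E_def f_def)
  have orth: "f m \<bullet> T (f m') = 0" if "m \<in> E" "m' \<in> E" "m \<noteq> m'" for m m'
  proof -
    have "f m \<bullet> T (L (f m')) = T (L (f m)) \<bullet> f m'" by (rule TL_sym)
    then have "(m' - m) * (f m \<bullet> T (f m')) = 0"
      by (simp add: f that linear_scale[OF linear_T] T_sym algebra_simps)
    then show ?thesis using that by simp
  qed
  have "independent (f ` E)"
    unfolding independent_explicit_finite_subsets
  proof (intro allI impI ballI)
    fix S u v
    assume S: "S \<subseteq> f ` E" "finite S" "(\<Sum>v\<in>S. u v *\<^sub>R v) = 0" "v \<in> S"
    have "0 = (\<Sum>w\<in>S. u w *\<^sub>R w) \<bullet> T v" by (simp add: S)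
    also have "\<dots> = (\<Sum>w\<in>S. u w * (w \<bullet> T v))" by (simp add: inner_sum_left)
    also have "\<dots> = u v * (v \<bullet> T v)"
    proof -
      have "w \<bullet> T v = 0" if w: "w \<in> S" "w \<noteq> v" for w
      proof -
        obtain m m' where "m \<in> E" "m' \<in> E" "w = f m" "v = f m'"
          using w(1) S(1,4) by blast
        then show ?thesis using orth w(2) by auto
      qed
      then have "(\<Sum>w\<in>S - {v}. u w * (w \<bullet> T v)) = 0" by (intro sum.neutral) auto
      then show ?thesis using sum.remove[OF S(2,4), of "\<lambda>w. u w * (w \<bullet> T v)"] by simp
    qed
    finally have "u v * (v \<bullet> T v) = 0" by simp
    moreover obtain m where "m \<in> E" "v = f m" using S(1,4) by blast
    then have "v \<bullet> T v > 0" using f(1)[of m] T_pos[of v] by simp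
    ultimately show "u v = 0" by simp
  qed
  then have "finite (f ` E)" by (rule independent_imp_finite)
  moreover have "inj_on f E"
  proof (rule inj_onI)
    fix m m' assume "m \<in> E" "m' \<in> E" "f m = f m'"
    then have "m *\<^sub>R f m = m' *\<^sub>R f m" using f(2)[of m] f(2)[of m'] by metis
    then show "m = m'" using f(1)[OF \<open>m \<in> E\<close>] by simp
  qed
  ultimately have "finite E" by (rule finite_imageD)
  moreover have "{\<mu>. op_eigenvalue L \<mu>} \<subseteq> of_real ` E"
  proof
    fix \<mu> assume "\<mu> \<in> {\<mu>. op_eigenvalue L \<mu>}"
    then have "op_eigenvalue L \<mu>" by simp
    then obtain m x where "\<mu> = of_real m" "x \<noteq> 0" "L x = m *\<^sub>R x"
      by (rule op_eigenvalue_real)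
    then show "\<mu> \<in> of_real ` E" unfolding E_def by blast
  qed
  ultimately show ?thesis by (meson finite_imageI finite_subset)
qed

lemma finite_real_op_eigenvalues: "finite {m. op_eigenvalue L (of_real m)}"
  using finite_vimageI[OF finite_op_eigenvalues inj_of_real] by (simp add: vimage_def)

text \<open>The Rayleigh maximizer for the pair T L and T satisfies T (L x) = m T x, and T is
  injective.\<close>

lemma ex_op_eigenvalue_upper:
  obtains m where "op_eigenvalue L (of_real m)" "\<And>z. z \<bullet> T (L z) \<le> m * (z \<bullet> T z)"
proof -
  have "linear (\<lambda>x. T (L x))" using linear_T linear_L by (rule linear_compose[unfolded o_def, rotated])
  then obtain m x where "x \<noteq> 0" "T (L x) = m *\<^sub>R T x" "\<And>z. z \<bullet> T (L z) \<le> m * (z \<bullet> T z)"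
    using generalized_Rayleigh_maximizer[of "\<lambda>x. T (L x)" T] linear_T TL_sym T_sym T_pos by metis
  moreover from this have "T (L x - m *\<^sub>R x) = 0" by (simp add: T_simps)
  then have "L x = m *\<^sub>R x" by (simp add: T_eq_0_iff)
  ultimately show thesis using that op_eigenvalueI by blast
qed

lemma largest_eigenvalue_properties:
  shows op_eigenvalue_largest: "op_eigenvalue L (of_real (largest_eigenvalue L))"
    and largest_eigenvalue_upper: "z \<bullet> T (L z) \<le> largest_eigenvalue L * (z \<bullet> T z)"
proof -
  obtain m where m: "op_eigenvalue L (of_real m)" "\<And>z. z \<bullet> T (L z) \<le> m * (z \<bullet> T z)"
    using ex_op_eigenvalue_upper by blast
  show "op_eigenvalue L (of_real (largest_eigenvalue L))"
    using Max_in[OF finite_real_op_eigenvalues] m(1) unfolding largest_eigenvalue_def by blast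
  have "m \<le> largest_eigenvalue L"
    using Max_ge[OF finite_real_op_eigenvalues] m(1) unfolding largest_eigenvalue_def by blast
  then have "m * (z \<bullet> T z) \<le> largest_eigenvalue L * (z \<bullet> T z)"
    by (rule mult_right_mono) (rule T_nonneg)
  then show "z \<bullet> T (L z) \<le> largest_eigenvalue L * (z \<bullet> T z)" using m(2)[of z] by linarith
qed

lemma smallest_eigenvalue_properties:
  shows op_eigenvalue_smallest: "op_eigenvalue L (of_real (smallest_eigenvalue L))"
    and smallest_eigenvalue_lower: "smallest_eigenvalue L * (z \<bullet> T z) \<le> z \<bullet> T (L z)"
proof -
  have "linear (\<lambda>x. - L x)" by (rule linear_compose_neg) (rule linear_L)
  moreover have "x \<bullet> T (- L y) = T (- L x) \<bullet> y" for x y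
    using TL_sym[of x y] by (simp add: linear_neg[OF linear_T])
  ultimately interpret neg: weighted_self_adjoint T "\<lambda>x. - L x"
    by (intro weighted_self_adjoint.intro linear_T T_sym T_pos)
  obtain m where m: "op_eigenvalue (\<lambda>x. - L x) (of_real m)" "\<And>z. z \<bullet> T (- L z) \<le> m * (z \<bullet> T z)"
    using neg.ex_op_eigenvalue_upper by blast
  obtain x where "x \<noteq> 0" "- L x = m *\<^sub>R x"
    using m(1) by (elim neg.op_eigenvalue_real) auto
  then have "op_eigenvalue L (of_real (- m))"
    by (intro op_eigenvalueI[of x]) (auto simp: minus_equation_iff[of "L x"])
  moreover have "- m * (z \<bullet> T z) \<le> z \<bullet> T (L z)" for z
    using m(2)[of z] by (simp add: linear_neg[OF linear_T])
  ultimately obtain l where l: "op_eigenvalue L (of_real l)" "\<And>z. l * (z \<bullet> T z) \<le> z \<bullet> T (L z)"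
    by blast
  show "op_eigenvalue L (of_real (smallest_eigenvalue L))"
    using Min_in[OF finite_real_op_eigenvalues] l(1) unfolding smallest_eigenvalue_def by blast
  have "smallest_eigenvalue L \<le> l"
    using Min_le[OF finite_real_op_eigenvalues] l(1) unfolding smallest_eigenvalue_def by blast
  then have "smallest_eigenvalue L * (z \<bullet> T z) \<le> l * (z \<bullet> T z)"
    by (rule mult_right_mono) (rule T_nonneg)
  then show "smallest_eigenvalue L * (z \<bullet> T z) \<le> z \<bullet> T (L z)" using l(2)[of z] by linarith
qed

lemma op_spectral_radius_le:
  assumes "\<And>z. \<bar>z \<bullet> T (L z)\<bar> \<le> q * (z \<bullet> T z)"
  shows "op_spectral_radius L \<le> q"
  unfolding op_spectral_radius_def
proof (subst Max_le_iff)
  show "finite (cmod ` {\<mu>. op_eigenvalue L \<mu>})" by (intro finite_imageI finite_op_eigenvalues)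
  show "cmod ` {\<mu>. op_eigenvalue L \<mu>} \<noteq> {}" using op_eigenvalue_largest by blast
  show "\<forall>a\<in>cmod ` {\<mu>. op_eigenvalue L \<mu>}. a \<le> q"
  proof safe
    fix \<mu> assume "op_eigenvalue L \<mu>"
    then obtain m x where "\<mu> = of_real m" "x \<noteq> 0" "L x = m *\<^sub>R x" by (rule op_eigenvalue_real)
    moreover from this have "\<bar>m\<bar> * (x \<bullet> T x) \<le> q * (x \<bullet> T x)"
      using assms[of x] T_nonneg[of x] by (simp add: linear_scale[OF linear_T] abs_mult)
    ultimately show "cmod \<mu> \<le> q" using T_pos[of x] by simp
  qed
qed

text \<open>Polarization turns a bound for the quadratic form into a bound for the operator norm.\<close>

lemma weighted_contraction:
  assumes "\<And>z. \<bar>z \<bullet> T (L z)\<bar> \<le> q * (z \<bullet> T z)" "q > 0"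
  shows "L z \<bullet> T (L z) \<le> q\<^sup>2 * (z \<bullet> T z)"
proof -
  \<comment> \<open>For this scaling 2 q times the weighted square of y is half of the left-hand
    side 4 times the product of y with T (L z), so it can be absorbed there.\<close>
  define y where "y = (1 / q) *\<^sub>R L z"
  have comm: "z \<bullet> T (L y) = y \<bullet> T (L z)"
    using TL_sym[of z y] by (simp add: inner_commute)
  have "4 * (y \<bullet> T (L z)) = (z + y) \<bullet> T (L (z + y)) - (z - y) \<bullet> T (L (z - y))"
    by (simp add: T_simps L_simps inner_add_left inner_diff_left
        inner_add_right inner_diff_right comm)
  also have "\<dots> \<le> q * ((z + y) \<bullet> T (z + y)) + q * ((z - y) \<bullet> T (z - y))"
    using assms(1)[of "z + y"] assms(1)[of "z - y"] by linarith
  also have "\<dots> = 2 * q * (z \<bullet> T z) + 2 * q * (y \<bullet> T y)"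
    by (simp add: T_simps inner_add_left inner_diff_left
        inner_add_right inner_diff_right algebra_simps)
  finally have "4 * (L z \<bullet> T (L z)) / q \<le> 2 * q * (z \<bullet> T z) + 2 * (L z \<bullet> T (L z)) / q"
    using assms(2) by (simp add: y_def linear_scale[OF linear_T])
  then show ?thesis
    using assms(2) by (simp add: field_simps power2_eq_square)
qed

end

section \<open>Canonical angles\<close>

lemma sum_list_map_mset:
  assumes "mset xs = image_mset d (mset_set A)"
  shows "sum_list (map g xs) = (\<Sum>i\<in>A. g (d i))"
proof -
  have "sum_list (map g xs) = sum_mset (image_mset g (mset xs))"
    by (metis mset_map sum_mset_sum_list)
  then show ?thesis
    by (simp add: assms sum_unfold_sum_mset image_mset.compositionality o_def)
qed

lemma pos_bounds: "1 \<le> pos j" "pos j \<le> CARD('k)" for j :: "'k::{finite,linorder}"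
proof -
  show "1 \<le> pos j" unfolding pos_def by (simp add: Suc_le_eq card_gt_0_iff) auto
  show "pos j \<le> CARD('k)" unfolding pos_def by (rule card_mono) auto
qed

text \<open>Positions count from 1 and list indices from 0. The bijection turns a sum over the
  diagonal of the angle matrix into a sum over the list of singular values.\<close>

lemma pos_bij_betw: "bij_betw (\<lambda>j::'k::{finite,linorder}. pos j - 1) UNIV {..<CARD('k)}"
proof -
  have pos_mono: "pos i < pos j" if "i < j" for i j :: 'k
  proof -
    have "{l. l \<le> i} \<subseteq> {l. l \<le> j}" "j \<in> {l. l \<le> j}" "j \<notin> {l. l \<le> i}" using that by auto
    then show ?thesis unfolding pos_def by (intro psubset_card_mono) auto
  qed
  have inj: "inj (\<lambda>j::'k. pos j - 1)"
  proof (rule injI)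
    fix i j :: 'k assume "pos i - 1 = pos j - 1"
    then have "pos i = pos j" using pos_bounds(1)[of i] pos_bounds(1)[of j] by linarith
    then show "i = j" using pos_mono by (metis less_irrefl linorder_neqE)
  qed
  moreover have "pos i - 1 < CARD('k)" for i :: 'k
    using pos_bounds[of i] by linarith
  ultimately show ?thesis
    by (intro bij_betw_imageI card_subset_eq) (auto simp: card_image)
qed

text \<open>With t the angle, d = cos^2 t and 1 - d = sin^2 t. The bounds are sin t \<le> t and t
  \<le> 3 sin t on [0, pi/2]; the 9 is the square of 3.\<close>

lemma arccos_sqrt_bounds:
  assumes "0 \<le> d" "d \<le> 1"
  shows "1 - d \<le> (arccos (sqrt d))\<^sup>2" "(arccos (sqrt d))\<^sup>2 \<le> 9 * (1 - d)"
proof -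
  define t where "t = arccos (sqrt d)"
  have rt: "0 \<le> sqrt d" "sqrt d \<le> 1" "- 1 \<le> sqrt d" using assms by (auto intro: order_trans[of _ 0])
  have t: "0 \<le> t" "t \<le> pi / 2" "cos t = sqrt d"
    using rt arccos_lbound[of "sqrt d"] arccos_le_pi2[of "sqrt d"] cos_arccos[of "sqrt d"]
    by (auto simp: t_def)
  have sin2: "1 - d = (sin t)\<^sup>2" using assms(1) by (simp add: sin_squared_eq t)
  have sin0: "0 \<le> sin t" using t pi_ge_zero by (intro sin_ge_zero) linarith+
  show "1 - d \<le> (arccos (sqrt d))\<^sup>2"
    unfolding sin2 t_def[symmetric] using t sin0 by (intro power_mono sin_x_le_x)
  have "\<bar>sin t - t\<bar> \<le> t ^ 3 / 6"
    using Maclaurin_sin_bound[of t 3] t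
    by (simp add: numeral_3_eq_3 sin_coeff_def fact_numeral)
  \<comment> \<open>From t \<le> pi/2 < 2 the cubic remainder t^3/6 is at most 2t/3, which leaves
    sin t \<ge> t/3.\<close>
  moreover have "t ^ 3 \<le> t * 4"
  proof -
    have "t * t \<le> 2 * 2" using t pi_less_4 by (intro mult_mono) linarith+
    then have "t * (t * t) \<le> t * 4" by (intro mult_left_mono) (use t in auto)
    then show ?thesis by (simp add: power3_eq_cube mult.assoc)
  qed
  ultimately have "t \<le> 3 * sin t" by linarith
  then have "t\<^sup>2 \<le> (3 * sin t)\<^sup>2" using t by (intro power_mono)
  then show "(arccos (sqrt d))\<^sup>2 \<le> 9 * (1 - d)"
    by (simp add: sin2 t_def power_mult_distrib)
qed

text \<open>Equivalence of norms in finite dimension: expansion in the basis gives the upper bound,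
  which makes N Lipschitz, and its minimum on the unit sphere gives the lower bound. It allows all
  estimates to be made in the Frobenius norm.\<close>

lemma unitarily_invariant_norm_equiv:
  fixes N :: "('k::finite, 'k) cmat \<Rightarrow> real"
  assumes "unitarily_invariant_norm N"
  obtains a b where "a > 0" "b > 0" "\<And>A. a * norm A \<le> N A" "\<And>A. N A \<le> b * norm A"
proof -
  have nonneg: "0 \<le> N A" and zero: "N A = 0 \<longleftrightarrow> A = 0" and tri: "N (A + B) \<le> N A + N B"
    and cscale: "N (\<chi> i j. c * A $ i $ j) = cmod c * N A" for A B c
    using assms by (auto simp: unitarily_invariant_norm_def)
  have scale: "N (r *\<^sub>R A) = \<bar>r\<bar> * N A" for r A
  proof -
    have "(\<chi> i j. complex_of_real r * A $ i $ j) = r *\<^sub>R A"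
      by (simp add: vec_eq_iff) (simp add: scaleR_conv_of_real)
    then show ?thesis using cscale[of "complex_of_real r" A] by simp
  qed
  define b where "b = (\<Sum>e\<in>Basis. N e) + 1"
  have sum: "N (\<Sum>i\<in>S. f i) \<le> (\<Sum>i\<in>S. N (f i))" if "finite S" for S and f :: "('k,'k) cmat \<Rightarrow> _"
    using that
  proof (induction S rule: finite_induct)
    case empty
    show ?case using zero[of 0] by simp
  next
    case (insert x F)
    then show ?case using tri[of "f x" "sum f F"] by simp
  qed
  have b: "b > 0" by (simp add: b_def add_nonneg_pos sum_nonneg nonneg)
  have upper: "N A \<le> b * norm A" for A
  proof -
    have "N A = N (\<Sum>e\<in>Basis. (A \<bullet> e) *\<^sub>R e)" by (simp add: euclidean_representation)
    also have "\<dots> \<le> (\<Sum>e\<in>Basis. N ((A \<bullet> e) *\<^sub>R e))" by (intro sum) simp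
    also have "\<dots> \<le> (\<Sum>e\<in>Basis. norm A * N e)"
      unfolding scale by (intro sum_mono mult_right_mono Basis_le_norm nonneg)
    also have "\<dots> \<le> b * norm A"
      unfolding b_def sum_distrib_left[symmetric] by (simp add: algebra_simps)
    finally show ?thesis .
  qed
  have diff: "N A - N B \<le> b * norm (A - B)" for A B
    using tri[of "A - B" B] upper[of "A - B"] by simp
  have lip: "\<bar>N A - N B\<bar> \<le> b * norm (A - B)" for A B
    using diff[of A B] diff[of B A] by (simp add: norm_minus_commute)
  have "b-lipschitz_on (sphere 0 1) N"
    using lip b by (intro lipschitz_onI) (auto simp: dist_norm)
  then have "continuous_on (sphere 0 1) N" by (rule lipschitz_on_continuous_on)
  moreover have "(sphere 0 1 :: ('k,'k) cmat set) \<noteq> {}" by simp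
  ultimately obtain A0 where A0: "A0 \<in> sphere 0 1" "\<And>A. A \<in> sphere 0 1 \<Longrightarrow> N A0 \<le> N A"
    using continuous_attains_inf[OF compact_sphere] by blast
  have "A0 \<noteq> 0" using A0(1) by auto
  then have "N A0 > 0" using nonneg[of A0] zero[of A0] by linarith
  moreover have "N A0 * norm A \<le> N A" for A
  proof (cases "A = 0")
    case True
    then show ?thesis using nonneg by simp
  next
    case False
    then have "N A0 \<le> N (A /\<^sub>R norm A)" by (intro A0(2)) simp
    then show ?thesis using False by (simp add: scale field_simps)
  qed
  ultimately show thesis using that[OF _ b _ upper] by blast
qed

context unitary_split
begin

lemma gram_Vp_Vs:
  fixes V :: "('n,'k) cmat"
  assumes "V \<in> stiefel"
  shows "ctranspose (ctranspose Vp ** V) ** (ctranspose Vp ** V)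
    = mat 1 - ctranspose (ctranspose Vs ** V) ** (ctranspose Vs ** V)"
  using gram_split[of V] stiefelD[OF assms] by (simp add: algebra_simps)

text \<open>The Gram matrices of Vs^H V and Vp^H V add up to the identity, so one unitary U
  diagonalizes both, with eigenvalues d_i and 1 - d_i (squared cosines and sines of the canonical
  angles). Each is a diagonal of squared norms, whence 0 \<le> d_i \<le> 1.\<close>

lemma singular_values:
  fixes V :: "('n,'k) cmat"
  assumes V: "V \<in> stiefel"
  obtains U :: "('k,'k) cmat" and d where "unitary U"
    "ctranspose (ctranspose Vs ** V) ** (ctranspose Vs ** V) = U ** diag (\<lambda>i. of_real (d i)) ** ctranspose U"
    "\<And>i. 0 \<le> d i" "\<And>i. d i \<le> 1" "(norm (ctranspose Vp ** V))\<^sup>2 = (\<Sum>i\<in>UNIV. 1 - d i)"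
    "norm (diag (\<lambda>i. of_real (1 - d i))) \<le> (norm (ctranspose Vp ** V))\<^sup>2"
proof -
  define C S where "C = ctranspose Vs ** V" and "S = ctranspose Vp ** V"
  have "hermitian (ctranspose C ** C)" by (simp add: hermitian_def)
  then obtain U :: "('k,'k) cmat" and d where U: "unitary U"
    and G: "ctranspose C ** C = U ** diag (\<lambda>i. of_real (d i)) ** ctranspose U"
    by (rule hermitian_diagonalization)
  have UU: "ctranspose U ** U = mat 1" "U ** ctranspose U = mat 1"
    using U by (simp_all add: unitary_def)
  have SU: "ctranspose (S ** U) ** (S ** U) = diag (\<lambda>i. of_real (1 - d i))"
  proof -
    have "ctranspose (S ** U) ** (S ** U) = ctranspose U ** (ctranspose S ** S) ** U"
      by (simp add: matrix_mul_assoc)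
    also have "ctranspose S ** S = mat 1 - U ** diag (\<lambda>i. of_real (d i)) ** ctranspose U"
      using gram_Vp_Vs[OF V] G by (simp add: S_def C_def)
    also have "ctranspose U ** (mat 1 - U ** diag (\<lambda>i. of_real (d i)) ** ctranspose U) ** U
      = ctranspose U ** U - (ctranspose U ** U) ** diag (\<lambda>i. of_real (d i)) ** (ctranspose U ** U)"
      by (simp add: cmat_algebra)
    also have "\<dots> = diag (\<lambda>i. of_real (1 - d i))"
      by (simp add: UU) (simp add: vec_eq_iff mat_def diag_def)
    finally show ?thesis .
  qed
  have CU: "ctranspose (C ** U) ** (C ** U) = diag (\<lambda>i. of_real (d i))"
  proof -
    have "ctranspose (C ** U) ** (C ** U) = ctranspose U ** (ctranspose C ** C) ** U"
      by (simp add: matrix_mul_assoc)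
    also have "\<dots> = (ctranspose U ** U) ** diag (\<lambda>i. of_real (d i)) ** (ctranspose U ** U)"
      by (simp add: G matrix_mul_assoc)
    finally show ?thesis by (simp add: UU)
  qed
  have gram_diag: "0 \<le> e i" if "ctranspose X ** X = diag (\<lambda>i. of_real (e i))"
    for X :: "('c::finite,'k) cmat" and e i
  proof -
    have "complex_of_real (e i) = (ctranspose X ** X) $ i $ i" by (simp add: that diag_def)
    also have "\<dots> = of_real (\<Sum>r\<in>UNIV. (cmod (X $ r $ i))\<^sup>2)"
      by (simp add: matrix_matrix_mult_def mult.commute flip: complex_norm_square)
    finally have "e i = (\<Sum>r\<in>UNIV. (cmod (X $ r $ i))\<^sup>2)" by (simp only: of_real_eq_iff)
    then show ?thesis by (simp add: sum_nonneg)
  qed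
  have nSU: "norm (S ** U) = norm S" by (rule norm_mult_unitary) (rule UU)
  have "(norm S)\<^sup>2 = Re (trace (ctranspose (S ** U) ** (S ** U)))"
    by (simp add: power2_norm_eq_inner inner_cmat flip: nSU)
  then have nS: "(norm S)\<^sup>2 = (\<Sum>i\<in>UNIV. 1 - d i)"
    unfolding SU by (simp add: trace_def diag_def)
  have "norm (diag (\<lambda>i. complex_of_real (1 - d i))) \<le> norm (S ** U) * norm (S ** U)"
    unfolding SU[symmetric] using norm_matrix_mult_le[of "ctranspose (S ** U)" "S ** U"]
    by (simp del: ctranspose_mult)
  then have "norm (diag (\<lambda>i. complex_of_real (1 - d i))) \<le> (norm S)\<^sup>2"
    by (simp add: nSU power2_eq_square)
  with U G gram_diag[OF CU] gram_diag[OF SU] nS show thesis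
    by (intro that[of U d]) (simp_all add: C_def S_def)
qed

text \<open>Summing \<open>arccos_sqrt_bounds\<close> over the squared cosines compares the angles
  with their sines. The separate ordered type \<open>'l\<close> of the same size stands in for
  \<open>'k\<close>, which carries no order in this locale.\<close>

lemma canonical_angles_bounds:
  fixes V :: "('n,'k) cmat"
  assumes V: "V \<in> stiefel"
    and angles: "\<Theta> = diag (\<lambda>j::'l::{finite,linorder}. of_real (arccos
      (descending_singular_values (ctranspose Vs ** V) ! (pos j - 1))))"
    and card: "CARD('l) = CARD('k)"
  shows "norm (ctranspose Vp ** V) \<le> norm \<Theta>" "norm \<Theta> \<le> 3 * norm (ctranspose Vp ** V)"
proof -
  obtain U :: "('k,'k) cmat" and d where U: "unitary U"
    and G: "ctranspose (ctranspose Vs ** V) ** (ctranspose Vs ** V) = U ** diag (\<lambda>i. of_real (d i)) ** ctranspose U"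
    and d: "\<And>i. 0 \<le> d i" "\<And>i. d i \<le> 1"
    and nS: "(norm (ctranspose Vp ** V))\<^sup>2 = (\<Sum>i\<in>UNIV. 1 - d i)"
    using singular_values[OF V] by metis
  define xs where "xs = descending_singular_values (ctranspose Vs ** V)"
  have ms: "mset xs = image_mset (\<lambda>i. sqrt (d i)) (mset_set UNIV)"
    unfolding xs_def descending_singular_values_def G mset_rev mset_map
      ascending_eigenvalues_diagonalizable[OF U]
    by (simp add: image_mset.compositionality o_def)
  then have len: "length xs = CARD('l)"
    unfolding card by (metis size_image_mset size_mset size_mset_set)
  have "(norm \<Theta>)\<^sup>2 = (\<Sum>j\<in>(UNIV::'l set). (arccos (xs ! (pos j - 1)))\<^sup>2)"
    unfolding angles norm_cmat_sq diag_def xs_def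
    by (simp add: if_distrib[of cmod] if_distrib[of "\<lambda>x. x\<^sup>2"] cong: if_cong)
  also have "\<dots> = (\<Sum>l<CARD('l). (arccos (xs ! l))\<^sup>2)"
    by (rule sum.reindex_bij_betw[OF pos_bij_betw])
  also have "\<dots> = sum_list (map (\<lambda>x. (arccos x)\<^sup>2) xs)"
    by (simp add: sum_list_sum_nth len atLeast0LessThan)
  also have "\<dots> = (\<Sum>i\<in>UNIV. (arccos (sqrt (d i)))\<^sup>2)"
    by (rule sum_list_map_mset[OF ms])
  finally have nT: "(norm \<Theta>)\<^sup>2 = (\<Sum>i\<in>UNIV. (arccos (sqrt (d i)))\<^sup>2)" .
  show "norm (ctranspose Vp ** V) \<le> norm \<Theta>"
  proof (rule power2_le_imp_le)
    show "(norm (ctranspose Vp ** V))\<^sup>2 \<le> (norm \<Theta>)\<^sup>2"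
      unfolding nT nS by (intro sum_mono arccos_sqrt_bounds d)
  qed simp
  have "(norm \<Theta>)\<^sup>2 \<le> 9 * (norm (ctranspose Vp ** V))\<^sup>2"
    unfolding nT nS sum_distrib_left by (intro sum_mono arccos_sqrt_bounds d)
  then show "norm \<Theta> \<le> 3 * norm (ctranspose Vp ** V)"
    by - (rule power2_le_imp_le, simp_all add: power_mult_distrib)
qed

text \<open>By polar decomposition of \<open>Vs\<^sup>H V\<close>, every basis of a nearby subspace can be rotated to
  agree with \<open>Vs\<close> up to second order in the \<open>Vs\<close>-component.\<close>

lemma aligned_basis:
  fixes V :: "('n,'k) cmat"
  assumes V: "V \<in> stiefel" and small: "norm (ctranspose Vp ** V) < 1"
  obtains Q :: "('k,'k) cmat" where "unitary Q"
    "norm (ctranspose Vs ** (V ** Q) - mat 1) \<le> CARD('k) * (norm (ctranspose Vp ** V))\<^sup>2"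
proof -
  define C where "C = ctranspose Vs ** V"
  obtain U :: "('k,'k) cmat" and d where U: "unitary U"
    and G: "ctranspose C ** C = U ** diag (\<lambda>i. of_real (d i)) ** ctranspose U"
    and d: "\<And>i. 0 \<le> d i" "\<And>i. d i \<le> 1"
    and nD: "norm (diag (\<lambda>i. of_real (1 - d i))) \<le> (norm (ctranspose Vp ** V))\<^sup>2"
    unfolding C_def using singular_values[OF V] by metis
  have UU: "ctranspose U ** U = mat 1" "U ** ctranspose U = mat 1"
    using U by (simp_all add: unitary_def)
  \<comment> \<open>If the complementary component has norm below 1, no squared cosine vanishes, so
    Vs^H V is invertible.\<close>
  have dpos: "d i > 0" for i
  proof -
    let ?D = "diag (\<lambda>i. complex_of_real (1 - d i))"
    have "\<bar>1 - d i\<bar> = cmod (?D $ i $ i)" by (simp add: diag_def flip: of_real_diff del: of_real_diff)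
    also have "\<dots> \<le> norm ?D" by (rule order_trans[OF Finite_Cartesian_Product.norm_nth_le Finite_Cartesian_Product.norm_nth_le])
    also have "\<dots> < 1" using nD small by (smt (verit) norm_ge_zero power2_le_iff_abs_le power_le_one power_less_one_iff zero_less_numeral abs_square_less_1)
    finally show ?thesis by simp
  qed
  define R where "R = diag (\<lambda>i. complex_of_real (1 / sqrt (d i)))"
  define P where "P = diag (\<lambda>i. complex_of_real (sqrt (d i)))"
  define X where "X = C ** U ** R"
  have RP: "R ** P = mat 1"
    unfolding R_def P_def diag_mult_diag using dpos
    by (auto simp: vec_eq_iff diag_def mat_def less_imp_neq[THEN not_sym])
  have R: "ctranspose R = R" by (simp add: R_def del: of_real_divide)
  have "ctranspose X ** X = R ** (ctranspose U ** (ctranspose C ** C) ** U) ** R"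
    by (simp add: X_def R matrix_mul_assoc)
  also have "ctranspose U ** (ctranspose C ** C) ** U
      = (ctranspose U ** U) ** diag (\<lambda>i. of_real (d i)) ** (ctranspose U ** U)"
    by (simp add: G matrix_mul_assoc)
  also have "R ** \<dots> ** R = mat 1"
    unfolding UU R_def diag_mult_diag matrix_mul_lid matrix_mul_rid of_real_mult[symmetric]
    using dpos by (auto simp: vec_eq_iff diag_def mat_def less_imp_neq[THEN not_sym] abs_of_pos)
  finally have X: "unitary X" by (rule unitaryI_left)
  then have XX: "X ** ctranspose X = mat 1" by (simp add: unitary_def)
  \<comment> \<open>C = X P U^H is a singular value decomposition, so Q is the inverse of its
    unitary polar factor X U^H and C Q = X P X^H is positive definite.\<close>
  define Q where "Q = U ** ctranspose X"
  have "X ** P = C ** U" by (simp add: X_def RP flip: matrix_mul_assoc)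
  then have CQ: "C ** Q = X ** P ** ctranspose X" by (simp add: Q_def matrix_mul_assoc)
  have "C ** Q - mat 1 = X ** (P - mat 1) ** ctranspose X"
    by (simp add: CQ cmat_algebra XX)
  then have "norm (C ** Q - mat 1) \<le> norm X * norm (P - mat 1) * norm (ctranspose X)"
    using order_trans[OF norm_matrix_mult_le mult_right_mono[OF norm_matrix_mult_le norm_ge_zero]]
    by (simp only:)
  \<comment> \<open>The Frobenius norms of X and X^H are sqrt k each, which is the origin of the
    constant in the alignment bound.\<close>
  also have "\<dots> = CARD('k) * norm (P - mat 1)"
    using norm_stiefel[of X] X by (simp add: stiefel_def unitary_def)
  also have "norm (P - mat 1) \<le> norm (diag (\<lambda>i. complex_of_real (1 - d i)))"
  proof (rule power2_le_imp_le)
    have "cmod ((P - mat 1) $ i $ j) \<le> cmod (diag (\<lambda>i. complex_of_real (1 - d i)) $ i $ j)" for i j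
    proof (cases "i = j")
      case True
      \<comment> \<open>Since sqrt d + 1 \<ge> 1, the defect of the cosine is at most that of its
        square, hence of second order in the sine.\<close>
      have "\<bar>sqrt (d i) - 1\<bar> * 1 \<le> \<bar>sqrt (d i) - 1\<bar> * \<bar>sqrt (d i) + 1\<bar>"
        using d(1)[of i] by (intro mult_left_mono) auto
      also have "\<dots> = \<bar>1 - d i\<bar>"
      proof -
        have "(sqrt (d i) - 1) * (sqrt (d i) + 1) = d i - 1"
          using d(1)[of i] by (simp add: algebra_simps)
        then show ?thesis unfolding abs_mult[symmetric] by (simp add: abs_minus_commute)
      qed
      finally have "\<bar>sqrt (d i) - 1\<bar> \<le> \<bar>1 - d i\<bar>" by simp
      moreover have "cmod (complex_of_real (sqrt (d i)) - 1) = \<bar>sqrt (d i) - 1\<bar>"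
        by (metis norm_of_real of_real_1 of_real_diff)
      ultimately show ?thesis
        using True by (simp add: P_def diag_def mat_def del: of_real_diff)
    qed (simp add: P_def diag_def mat_def)
    then show "(norm (P - mat 1))\<^sup>2 \<le> (norm (diag (\<lambda>i. complex_of_real (1 - d i))))\<^sup>2"
      unfolding norm_cmat_sq by (intro sum_mono power_mono) auto
  qed simp
  also have "\<dots> \<le> (norm (ctranspose Vp ** V))\<^sup>2" by (rule nD)
  finally have "norm (C ** Q - mat 1) \<le> CARD('k) * (norm (ctranspose Vp ** V))\<^sup>2"
    by (simp add: mult_left_mono)
  moreover have "unitary Q" unfolding Q_def using U X by (intro unitary_mult unitary_ctranspose)
  ultimately show thesis using that by (simp add: C_def matrix_mul_assoc)
qed

end

section \<open>Local convergence of invariant subspace iterations\<close>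

lemma norm_matrix_mult3_le: "norm (A ** B ** C) \<le> norm A * norm B * norm C"
  for A :: "('a::finite,'b::finite) cmat" and B :: "('b,'c::finite) cmat" and C :: "('c,'d::finite) cmat"
  by (rule order_trans[OF norm_matrix_mult_le mult_right_mono[OF norm_matrix_mult_le norm_ge_zero]])

lemma trace_conj_le: "\<bar>Re (trace (ctranspose W ** E ** W))\<bar> \<le> (norm W)\<^sup>2 * norm E"
  for W :: "('n::finite,'k::finite) cmat"
proof -
  have "Re (trace (ctranspose W ** E ** W)) = W \<bullet> (E ** W)"
    by (simp add: inner_cmat matrix_mul_assoc)
  also have "\<bar>\<dots>\<bar> \<le> norm W * norm (E ** W)" by (rule Cauchy_Schwarz_ineq2)
  also have "\<dots> \<le> norm W * (norm E * norm W)" by (intro mult_left_mono norm_matrix_mult_le) simp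
  finally show ?thesis by (simp add: power2_eq_square mult_ac)
qed

text \<open>A general self-consistent iteration with matrix function F near a fixed subspace. For
  the level shift, \<open>a\<close> holds the k eigenvalues moved by -\<sigma> and \<open>b\<close>
  the remaining ones, so \<gamma> is the shifted gap.\<close>

locale invariant_subspace_iteration = unitary_split Vs Vp
  for Vs :: "('n::finite,'k::finite) cmat" and Vp :: "('n,'m::finite) cmat" +
  fixes F :: "('n,'k) cmat \<Rightarrow> ('n,'n) cmat" and F' :: "('n,'k) cmat \<Rightarrow> ('n,'n) cmat"
    and a :: "'k \<Rightarrow> real" and b :: "'m \<Rightarrow> real" and \<alpha> \<gamma> :: real
  assumes F_herm: "\<And>V. hermitian (F V)"
    and F_inv: "\<And>V Q. unitary Q \<Longrightarrow> F (V ** Q) = F V"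
    and F_deriv: "(F has_derivative F') (at Vs)"
    and F_Vs: "F Vs ** Vs = Vs ** diag (\<lambda>j. of_real (a j))"
    and F_Vp: "F Vs ** Vp = Vp ** diag (\<lambda>i. of_real (b i))"
    and a_le: "\<And>j. a j \<le> \<alpha>" and b_ge: "\<And>i. \<alpha> + \<gamma> \<le> b i" and gap: "\<gamma> > 0"
begin

text \<open>The Sylvester operator of the two diagonal blocks of \<open>F Vs\<close>; on entries it
  is multiplication by b_i - a_j.\<close>

definition T :: "('m,'k) cmat \<Rightarrow> ('m,'k) cmat" where
  "T Z = diag (\<lambda>i. of_real (b i)) ** Z - Z ** diag (\<lambda>j. of_real (a j))"

text \<open>First-order change of the off-diagonal block of F when the subspace is tilted by
  Z.\<close>

definition M :: "('m,'k) cmat \<Rightarrow> ('m,'k) cmat" where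
  "M Z = ctranspose Vp ** F' (Vp ** Z) ** Vs"

abbreviation aligned :: "('n,'k) cmat \<Rightarrow> bool" where
  "aligned V \<equiv> norm (ctranspose Vs ** V - mat 1) \<le> CARD('k) * (norm (ctranspose Vp ** V))\<^sup>2"

section \<open>One step of the iteration near the fixed subspace\<close>

text \<open>W is optimal for A and Vs for \<open>F Vs\<close>. Comparing both traces,
  \<open>trace_gap\<close> bounds the loss of W from below, while passing between A and
  \<open>F Vs\<close> costs at most k |A - F Vs| at each of the two bases.\<close>

lemma trace_minimizer_perturbation:
  fixes W :: "('n,'k) cmat"
  assumes "trace_minimizer A W"
  shows "\<gamma> * (norm (ctranspose Vp ** W))\<^sup>2 \<le> 2 * CARD('k) * norm (A - F Vs)"
proof -
  define E where "E = A - F Vs"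
  have W: "W \<in> stiefel" using assms by (simp add: trace_minimizer_def)
  have A: "A = F Vs + E" by (simp add: E_def)
  have split: "Re (trace (ctranspose X ** A ** X))
      = Re (trace (ctranspose X ** F Vs ** X)) + Re (trace (ctranspose X ** E ** X))" for X :: "('n,'k) cmat"
    by (simp add: A cmat_algebra trace_add)
  have "Re (trace (ctranspose W ** A ** W)) \<le> Re (trace (ctranspose Vs ** A ** Vs))"
    using assms Vs_stiefel by (simp add: trace_minimizer_def)
  moreover have "\<gamma> * (norm (ctranspose Vp ** W))\<^sup>2
      \<le> Re (trace (ctranspose W ** F Vs ** W)) - Re (trace (ctranspose Vs ** F Vs ** Vs))"
    by (rule trace_gap[OF W F_Vs F_Vp a_le b_ge])
  moreover have "\<bar>Re (trace (ctranspose W ** E ** W))\<bar> \<le> CARD('k) * norm E"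
    "\<bar>Re (trace (ctranspose Vs ** E ** Vs))\<bar> \<le> CARD('k) * norm E"
    using trace_conj_le[of W E] trace_conj_le[of Vs E]
    by (simp_all add: norm_stiefel_sq W Vs_stiefel)
  ultimately show ?thesis
    unfolding split E_def[symmetric] by linarith
qed

lemma aligned_dist:
  assumes "aligned V" "norm (ctranspose Vp ** V) \<le> 1"
  shows "norm (V - Vs) \<le> (norm Vs * CARD('k) + norm Vp) * norm (ctranspose Vp ** V)"
    (is "_ \<le> (_ + _) * ?y")
proof -
  have "V - Vs = Vs ** (ctranspose Vs ** V - mat 1) + Vp ** (ctranspose Vp ** V)"
    by (subst split[of V]) (simp add: matrix_diff_ldistrib)
  then have "norm (V - Vs) \<le> norm Vs * norm (ctranspose Vs ** V - mat 1) + norm Vp * ?y"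
    by (metis add_mono norm_matrix_mult_le norm_triangle_le)
  also have "norm Vs * norm (ctranspose Vs ** V - mat 1) \<le> norm Vs * (CARD('k) * ?y)"
  proof (rule mult_left_mono)
    have "?y\<^sup>2 \<le> ?y * 1" unfolding power2_eq_square using assms(2) by (intro mult_left_mono) auto
    then have "CARD('k) * ?y\<^sup>2 \<le> CARD('k) * ?y" by (intro mult_left_mono) auto
    with assms(1) show "norm (ctranspose Vs ** V - mat 1) \<le> CARD('k) * ?y" by linarith
  qed simp
  finally show ?thesis by (simp add: algebra_simps)
qed

text \<open>An exact form of the Sylvester equation for the next component: the (Vp, W) block of A W
  = W (W^H A W), rewritten with A = F Vs + E. On the left stands the linearization; on the right
  every term is Y' times a small matrix, E times W - Vs, or the error of replacing E by its
  derivative in the direction Vp Y.\<close>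

lemma step_identity:
  fixes V W :: "('n,'k) cmat"
  assumes W: "trace_minimizer (F V) W"
  defines "E \<equiv> F V - F Vs" and "Y \<equiv> ctranspose Vp ** V" and "Y' \<equiv> ctranspose Vp ** W"
  shows "T Y' + M Y = Y' ** (ctranspose W ** E ** W + ctranspose W ** F Vs ** (W - Vs)
      + ctranspose (W - Vs) ** F Vs ** Vs)
    - ctranspose Vp ** E ** (W - Vs) - ctranspose Vp ** (E - F' (Vp ** Y)) ** Vs"
proof -
  let ?a = "diag (\<lambda>j. complex_of_real (a j))" and ?b = "diag (\<lambda>i. complex_of_real (b i))"
  define A where "A = F V"
  have E: "E = A - F Vs" by (simp add: E_def A_def)
  have A: "ctranspose (F Vs) = F Vs" by (rule hermitianD[OF F_herm])
  have Vp_A: "ctranspose Vp ** F Vs = ?b ** ctranspose Vp"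
    using arg_cong[OF F_Vp, of ctranspose] by (simp add: A)
  have a: "ctranspose Vs ** F Vs ** Vs = ?a"
    by (metis F_Vs Vs_Vs matrix_mul_assoc matrix_mul_lid)
  \<comment> \<open>Telescoping from W^H A W to Vs^H (F Vs) Vs, changing one factor at a
    time.\<close>
  have "ctranspose W ** E ** W + ctranspose W ** F Vs ** (W - Vs) + ctranspose (W - Vs) ** F Vs ** Vs
      = ctranspose W ** A ** W - ?a"
    by (simp add: E cmat_algebra flip: a)
  moreover have "ctranspose Vp ** (A ** W) = Y' ** (ctranspose W ** A ** W)"
    using W by (simp add: trace_minimizer_def A_def Y'_def matrix_mul_assoc)
  moreover have "ctranspose Vp ** (A ** W) = ctranspose Vp ** E ** W + ?b ** Y'"
  proof -
    have "ctranspose Vp ** (A ** W) = ctranspose Vp ** E ** W + (ctranspose Vp ** F Vs) ** W"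
      by (simp add: E cmat_algebra)
    then show ?thesis by (simp add: Vp_A Y'_def matrix_mul_assoc)
  qed
  ultimately show ?thesis
    by (simp add: T_def M_def cmat_algebra)
qed

text \<open>With y and y' the norms of the components of V and W, the a priori bound gives y' =
  O(sqrt y). It is inserted only into the coefficients in \<open>step_identity\<close>, so one
  factor y or y' remains outside and its coefficient can be made at most \<eta>.\<close>

lemma step_estimate:
  assumes "\<eta> > 0"
  obtains r where "r > 0"
    "\<And>V W. V \<in> stiefel \<Longrightarrow> aligned V \<Longrightarrow> norm (ctranspose Vp ** V) < r \<Longrightarrow>
      trace_minimizer (F V) (W :: ('n,'k) cmat) \<Longrightarrow> norm (ctranspose Vp ** W) < 1"
    "\<And>V W. V \<in> stiefel \<Longrightarrow> aligned V \<Longrightarrow> norm (ctranspose Vp ** V) < r \<Longrightarrow>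
      trace_minimizer (F V) W \<Longrightarrow> aligned W \<Longrightarrow>
      norm (T (ctranspose Vp ** W) + M (ctranspose Vp ** V))
        \<le> \<eta> * (norm (ctranspose Vp ** V) + norm (ctranspose Vp ** W))"
proof -
  define k :: real where "k = CARD('k)"
  define p v where "p = norm Vp" and "v = norm Vs"
  define c1 where "c1 = v * k + p"
  have bl: "bounded_linear F'" by (rule has_derivative_bounded_linear[OF F_deriv])
  obtain B where B: "B > 0" "\<And>X. norm (F' X) \<le> norm X * B"
    using bounded_linear.pos_bounded[OF bl] by blast
  \<comment> \<open>Lipschitz constant of F at Vs in terms of y: the derivative along Vp Y, the
    second-order component along Vs (with y^2 \<le> y), and the differentiability remainder (with
    \<epsilon> \<le> 1).\<close>
  define c2 where "c2 = B * p + B * (v * k) + c1"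
  \<comment> \<open>The constant in y' \<le> c4 sqrt y, from
    \<open>trace_minimizer_perturbation\<close> and c2.\<close>
  define c4 where "c4 = sqrt (2 * k * c2 / \<gamma>)"
  \<comment> \<open>Dominates the coefficients of sqrt y with which y' and y appear in the final
    estimate.\<close>
  define K where "K = k * c2 + 2 * v * norm (F Vs) * c1 * c4 + p * c1 * c2 + p * v * B * (v * k)"
  have k: "k > 0" by (simp add: k_def)
  have nn: "p \<ge> 0" "v \<ge> 0" "c1 \<ge> 0" "c2 \<ge> 0" "c4 \<ge> 0" "K \<ge> 0"
    using k B(1) gap by (simp_all add: p_def v_def c1_def c2_def c4_def K_def)
  \<comment> \<open>The differentiability error contributes p v c1 \<epsilon> y and is given half of
    \<eta>; the added 1 keeps the denominator positive.\<close>
  define \<epsilon> where "\<epsilon> = min 1 (\<eta> / (2 * (p * v * c1 + 1)))"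
  have \<epsilon>: "\<epsilon> > 0" "\<epsilon> \<le> 1" "p * v * c1 * \<epsilon> \<le> \<eta> / 2"
  proof -
    show "\<epsilon> > 0" "\<epsilon> \<le> 1" using assms nn by (simp_all add: \<epsilon>_def add_nonneg_pos)
    have "p * v * c1 * \<epsilon> \<le> (p * v * c1 + 1) * (\<eta> / (2 * (p * v * c1 + 1)))"
      using nn \<open>\<epsilon> > 0\<close> by (intro mult_mono) (auto simp: \<epsilon>_def)
    also have "\<dots> = \<eta> / 2" using nn by (simp add: field_simps add_nonneg_eq_0_iff)
    finally show "p * v * c1 * \<epsilon> \<le> \<eta> / 2" .
  qed
  obtain d where d: "d > 0"
    "\<And>V. norm (V - Vs) < d \<Longrightarrow> norm (F V - F Vs - F' (V - Vs)) \<le> \<epsilon> * norm (V - Vs)"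
    using F_deriv \<epsilon>(1) unfolding has_derivative_at_alt by blast
  \<comment> \<open>The four bounds ensure y \<le> 1, V within the differentiability radius d, K
    sqrt y \<le> \<eta>/2, and c4 sqrt y < 1.\<close>
  define r where "r = min (min 1 (d / (c1 + 1))) (min ((\<eta> / (2 * (K + 1)))\<^sup>2) ((1 / (c4 + 1))\<^sup>2))"
  have r: "r > 0" using d(1) nn assms by (auto simp: r_def intro!: divide_pos_pos zero_less_power add_nonneg_pos)
  have perturb: "norm (F V - F Vs - F' (Vp ** (ctranspose Vp ** V)))
        \<le> B * (v * k) * (norm (ctranspose Vp ** V))\<^sup>2 + \<epsilon> * c1 * norm (ctranspose Vp ** V)"
      "norm (F V - F Vs) \<le> c2 * norm (ctranspose Vp ** V)"
    if V: "aligned V" "norm (ctranspose Vp ** V) < r" for V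
  proof -
    define y where "y = norm (ctranspose Vp ** V)"
    have y: "y \<ge> 0" "y \<le> 1" "y < d / (c1 + 1)" using V(2) by (auto simp: y_def r_def)
    have dist: "norm (V - Vs) \<le> c1 * y"
      using aligned_dist[OF V(1)] y by (simp add: y_def c1_def v_def p_def k_def)
    also have "\<dots> \<le> (c1 + 1) * y" using y by (intro mult_right_mono) auto
    also have "\<dots> < d" using y(3) nn by (simp add: field_simps add_nonneg_pos)
    finally have "norm (F V - F Vs - F' (V - Vs)) \<le> \<epsilon> * norm (V - Vs)" by (rule d(2))
    also have "\<dots> \<le> \<epsilon> * (c1 * y)" using dist \<epsilon> by (intro mult_left_mono) auto
    finally have rem: "norm (F V - F Vs - F' (V - Vs)) \<le> \<epsilon> * (c1 * y)" .
    have "V - Vs = Vp ** (ctranspose Vp ** V) + Vs ** (ctranspose Vs ** V - mat 1)"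
      by (subst split[of V]) (simp add: matrix_diff_ldistrib)
    then have F'_split: "F' (V - Vs) = F' (Vp ** (ctranspose Vp ** V)) + F' (Vs ** (ctranspose Vs ** V - mat 1))"
      using linear_add[OF bounded_linear.linear[OF bl]] by metis
    have "norm (F' (Vs ** (ctranspose Vs ** V - mat 1))) \<le> norm (Vs ** (ctranspose Vs ** V - mat 1)) * B"
      by (rule B(2))
    also have "\<dots> \<le> (v * (k * y\<^sup>2)) * B"
      using V(1) B(1) unfolding v_def k_def y_def
      by (intro mult_right_mono order_trans[OF norm_matrix_mult_le mult_left_mono]) auto
    finally have sec: "norm (F' (Vs ** (ctranspose Vs ** V - mat 1))) \<le> B * (v * k) * y\<^sup>2"
      by (simp add: mult_ac)
    have "F V - F Vs - F' (Vp ** (ctranspose Vp ** V))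
        = (F V - F Vs - F' (V - Vs)) + F' (Vs ** (ctranspose Vs ** V - mat 1))"
      by (simp add: F'_split)
    then have "norm (F V - F Vs - F' (Vp ** (ctranspose Vp ** V)))
        \<le> norm (F V - F Vs - F' (V - Vs)) + norm (F' (Vs ** (ctranspose Vs ** V - mat 1)))"
      by (metis norm_triangle_ineq)
    with rem sec show first: "norm (F V - F Vs - F' (Vp ** (ctranspose Vp ** V)))
        \<le> B * (v * k) * (norm (ctranspose Vp ** V))\<^sup>2 + \<epsilon> * c1 * norm (ctranspose Vp ** V)"
      by (simp add: y_def mult_ac)
    have "norm (F' (Vp ** (ctranspose Vp ** V))) \<le> norm (Vp ** (ctranspose Vp ** V)) * B" by (rule B(2))
    also have "\<dots> \<le> (p * y) * B"
      unfolding p_def y_def using B(1) by (intro mult_right_mono norm_matrix_mult_le) auto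
    finally have "norm (F' (Vp ** (ctranspose Vp ** V))) \<le> B * p * y" by (simp add: mult_ac)
    moreover have "B * (v * k) * y\<^sup>2 \<le> B * (v * k) * y"
      using y B(1) nn k by (intro mult_left_mono) (auto simp: power2_eq_square mult_left_le)
    moreover have "\<epsilon> * c1 * y \<le> c1 * y" using y nn \<epsilon> by (intro mult_right_mono) (auto simp: mult_left_le_one_le)
    moreover have "norm (F V - F Vs) \<le> norm (F V - F Vs - F' (Vp ** (ctranspose Vp ** V)))
        + norm (F' (Vp ** (ctranspose Vp ** V)))"
      by (metis diff_add_cancel norm_triangle_ineq)
    ultimately have "norm (F V - F Vs) \<le> B * p * y + B * (v * k) * y + c1 * y"
      using first unfolding y_def[symmetric] by linarith
    then show "norm (F V - F Vs) \<le> c2 * norm (ctranspose Vp ** V)"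
      by (simp add: c2_def y_def algebra_simps)
  qed
  have next_small: "norm (ctranspose Vp ** W) \<le> c4 * sqrt (norm (ctranspose Vp ** V))"
    if V: "aligned V" "norm (ctranspose Vp ** V) < r" and W: "trace_minimizer (F V) W" for V W :: "('n,'k) cmat"
  proof (rule power2_le_imp_le)
    have "\<gamma> * (norm (ctranspose Vp ** W))\<^sup>2 \<le> 2 * k * norm (F V - F Vs)"
      using trace_minimizer_perturbation[OF W] by (simp add: k_def)
    also have "\<dots> \<le> 2 * k * (c2 * norm (ctranspose Vp ** V))"
      using k by (intro mult_left_mono perturb V) auto
    finally have "(norm (ctranspose Vp ** W))\<^sup>2 \<le> 2 * k * c2 / \<gamma> * norm (ctranspose Vp ** V)"
      using gap by (simp add: field_simps)
    then show "(norm (ctranspose Vp ** W))\<^sup>2 \<le> (c4 * sqrt (norm (ctranspose Vp ** V)))\<^sup>2"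
      using k nn gap by (simp add: power_mult_distrib c4_def)
  qed (use nn in simp)
  show thesis
  proof (rule that[OF r])
    fix V W :: "('n,'k) cmat"
    assume V: "V \<in> stiefel" "aligned V" "norm (ctranspose Vp ** V) < r" and W: "trace_minimizer (F V) W"
    define y y' where "y = norm (ctranspose Vp ** V)" and "y' = norm (ctranspose Vp ** W)"
    have y: "y \<ge> 0" "y \<le> 1" "y < (\<eta> / (2 * (K + 1)))\<^sup>2" "y < (1 / (c4 + 1))\<^sup>2" and y': "y' \<ge> 0"
      using V(3) by (auto simp: y_def y'_def r_def)
    have sq: "sqrt y < \<eta> / (2 * (K + 1))" "sqrt y < 1 / (c4 + 1)" "y \<le> sqrt y"
    proof -
      show "sqrt y < \<eta> / (2 * (K + 1))"
        using y(3) nn assms by (intro real_less_lsqrt y) auto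
      show "sqrt y < 1 / (c4 + 1)"
        using y(4) nn by (intro real_less_lsqrt y) auto
      show "y \<le> sqrt y" using y by (intro real_le_rsqrt) (auto simp: power2_eq_square mult_left_le)
    qed
    have y'_le: "y' \<le> c4 * sqrt y" unfolding y_def y'_def by (rule next_small[OF V(2,3) W])
    also have "\<dots> \<le> (c4 + 1) * sqrt y" using y by (intro mult_right_mono) auto
    also have "\<dots> < 1" using sq(2) nn by (simp add: field_simps add_nonneg_pos)
    finally have y'1: "y' < 1" .
    then show "norm (ctranspose Vp ** W) < 1" by (simp add: y'_def)
    assume aW: "aligned W"
    define E where "E = F V - F Vs"
    have Wst: "W \<in> stiefel" using W by (simp add: trace_minimizer_def)
    have nE: "norm E \<le> c2 * y" unfolding E_def y_def by (rule perturb(2)[OF V(2,3)])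
    have nW: "norm (W - Vs) \<le> c1 * y'"
      using aligned_dist[OF aW] y'1 by (simp add: y'_def c1_def v_def p_def k_def)
    have nWv: "norm W = v" by (simp add: v_def norm_stiefel Wst Vs_stiefel)
    have vv: "v * v = k"
      using norm_stiefel_sq[OF Vs_stiefel] by (simp add: v_def k_def power2_eq_square)
    let ?X = "ctranspose W ** E ** W + ctranspose W ** F Vs ** (W - Vs) + ctranspose (W - Vs) ** F Vs ** Vs"
    have "norm ?X \<le> norm (ctranspose W ** E ** W) + norm (ctranspose W ** F Vs ** (W - Vs))
        + norm (ctranspose (W - Vs) ** F Vs ** Vs)"
      by (intro norm_triangle_le add_mono) auto
    also have "\<dots> \<le> v * norm E * v + v * norm (F Vs) * norm (W - Vs) + norm (W - Vs) * norm (F Vs) * v"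
      using norm_matrix_mult3_le[of "ctranspose W" E W] norm_matrix_mult3_le[of "ctranspose W" "F Vs" "W - Vs"]
        norm_matrix_mult3_le[of "ctranspose (W - Vs)" "F Vs" Vs]
      unfolding norm_ctranspose nWv v_def[symmetric] by (intro add_mono)
    also have "\<dots> = k * norm E + 2 * v * norm (F Vs) * norm (W - Vs)"
      by (simp add: mult_ac flip: vv)
    also have "\<dots> \<le> k * (c2 * y) + 2 * v * norm (F Vs) * (c1 * y')"
      using nE nW k nn by (intro add_mono mult_left_mono) auto
    \<comment> \<open>Both y \<le> sqrt y and y' \<le> c4 sqrt y are used, so that a single small
      quantity bounds the whole factor of Y'.\<close>
    also have "\<dots> \<le> k * (c2 * sqrt y) + 2 * v * norm (F Vs) * (c1 * (c4 * sqrt y))"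
      using k nn y'_le sq by (intro add_mono mult_left_mono) auto
    finally have nX: "norm ?X \<le> (k * c2 + 2 * v * norm (F Vs) * c1 * c4) * sqrt y"
      by (simp add: algebra_simps)
    have t1: "norm ((ctranspose Vp ** W) ** ?X) \<le> y' * ((k * c2 + 2 * v * norm (F Vs) * c1 * c4) * sqrt y)"
      unfolding y'_def by (intro order_trans[OF norm_matrix_mult_le mult_left_mono] nX) simp
    have t2: "norm (ctranspose Vp ** E ** (W - Vs)) \<le> p * (c2 * sqrt y) * (c1 * y')"
    proof -
      have "norm (ctranspose Vp ** E ** (W - Vs)) \<le> p * norm E * norm (W - Vs)"
        using norm_matrix_mult3_le[of "ctranspose Vp" E "W - Vs"] by (simp add: p_def)
      also have "\<dots> \<le> p * (c2 * sqrt y) * (c1 * y')"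
        using nn y nE nW sq(3) by (intro mult_mono mult_left_mono order_trans[OF nE]) auto
      finally show ?thesis .
    qed
    have t3: "norm (ctranspose Vp ** (E - F' (Vp ** (ctranspose Vp ** V))) ** Vs)
        \<le> p * v * (B * (v * k) * sqrt y * y + \<epsilon> * c1 * y)"
    proof -
      have "norm (ctranspose Vp ** (E - F' (Vp ** (ctranspose Vp ** V))) ** Vs)
        \<le> p * norm (E - F' (Vp ** (ctranspose Vp ** V))) * v"
        using norm_matrix_mult3_le[of "ctranspose Vp" "E - F' (Vp ** (ctranspose Vp ** V))" Vs]
        by (simp add: p_def v_def)
      also have "\<dots> \<le> p * (B * (v * k) * y\<^sup>2 + \<epsilon> * c1 * y) * v"
        using perturb(1)[OF V(2,3)] nn unfolding E_def y_def by (intro mult_right_mono mult_left_mono) auto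
      also have "\<dots> \<le> p * (B * (v * k) * sqrt y * y + \<epsilon> * c1 * y) * v"
        using nn k y sq(3) B(1) unfolding power2_eq_square mult.assoc[symmetric]
        by (intro mult_right_mono mult_left_mono add_right_mono) auto
      finally show ?thesis by (simp add: mult_ac)
    qed
    have "norm (T (ctranspose Vp ** W) + M (ctranspose Vp ** V)) \<le>
        norm ((ctranspose Vp ** W) ** ?X) + norm (ctranspose Vp ** E ** (W - Vs))
        + norm (ctranspose Vp ** (E - F' (Vp ** (ctranspose Vp ** V))) ** Vs)"
      unfolding step_identity[OF W] E_def[symmetric]
      by (intro order_trans[OF norm_triangle_ineq4] add_mono) auto
    also have "\<dots> \<le> y' * ((k * c2 + 2 * v * norm (F Vs) * c1 * c4) * sqrt y) + p * (c2 * sqrt y) * (c1 * y')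
        + p * v * (B * (v * k) * sqrt y * y + \<epsilon> * c1 * y)"
      by (intro add_mono t1 t2 t3)
    also have "\<dots> = ((k * c2 + 2 * v * norm (F Vs) * c1 * c4 + p * c1 * c2) * sqrt y) * y'
        + (p * v * B * (v * k) * sqrt y + p * v * c1 * \<epsilon>) * y"
      by (simp add: algebra_simps)
    also have "\<dots> \<le> (K * sqrt y) * y' + (K * sqrt y + \<eta> / 2) * y"
    proof -
      have "k * c2 + 2 * v * norm (F Vs) * c1 * c4 + p * c1 * c2 \<le> K" "p * v * B * (v * k) \<le> K"
        using nn k B(1) by (simp_all add: K_def)
      then show ?thesis using y y' \<epsilon>(3) by (intro add_mono mult_right_mono) auto
    qed
    also have "\<dots> \<le> \<eta> * y' + \<eta> * y"
    proof -
      have "K * sqrt y \<le> (K + 1) * (\<eta> / (2 * (K + 1)))"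
        using nn sq(1) y by (intro mult_mono) auto
      also have "\<dots> = \<eta> / 2" using nn by (simp add: field_simps)
      finally have "K * sqrt y \<le> \<eta> / 2" .
      then show ?thesis using y y' assms by (intro add_mono mult_right_mono) auto
    qed
    finally show "norm (T (ctranspose Vp ** W) + M (ctranspose Vp ** V))
        \<le> \<eta> * (norm (ctranspose Vp ** V) + norm (ctranspose Vp ** W))"
      by (simp add: y_def y'_def algebra_simps)
  qed
qed

text \<open>\<open>T\<close> multiplies each entry by a positive weight, so \<open>norm (scaled Z)\<close> is the norm induced by
  the inner product \<open>\<langle>X, T Z\<rangle>\<close>.\<close>

definition scaled :: "('m,'k) cmat \<Rightarrow> ('m,'k) cmat" where
  "scaled Z = hadamard (\<chi> i j. sqrt (b i - a j)) Z"

section \<open>Comparison of the weighted and the Frobenius norm\<close>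

lemma weight_ge: "\<gamma> \<le> b i - a j"
  using a_le[of j] b_ge[of i] by linarith

lemma T_nth: "T Z $ i $ j = of_real (b i - a j) * Z $ i $ j"
  by (simp add: T_def algebra_simps)

lemma T_altdef: "T Z = hadamard (\<chi> i j. b i - a j) Z"
  by (simp add: vec_eq_iff T_nth hadamard_def)

lemma linear_hadamard: "linear (hadamard D)"
  by (intro linearI) (simp_all add: vec_eq_iff hadamard_def distrib_left)

lemma linear_T: "linear T"
  by (intro linearI) (simp_all add: T_def cmat_algebra algebra_simps)

lemma inner_hadamard: "X \<bullet> hadamard D Z = (\<Sum>i\<in>UNIV. \<Sum>j\<in>UNIV. D $ i $ j * (X $ i $ j \<bullet> Z $ i $ j))"
  by (simp add: inner_vec_def hadamard_def flip: scaleR_conv_of_real)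

lemma T_sym: "X \<bullet> T Z = T X \<bullet> Z"
  unfolding T_altdef inner_commute[of "hadamard _ _"] inner_hadamard by (simp add: inner_commute)

lemma norm_scaled_sq: "(norm (scaled Z))\<^sup>2 = Z \<bullet> T Z"
proof -
  have "(cmod (of_real (sqrt (b i - a j)) * z))\<^sup>2 = (b i - a j) * (z \<bullet> z)" for i j z
    using weight_ge[of i j] gap by (simp add: norm_mult power_mult_distrib power2_norm_eq_inner)
  then show ?thesis
    unfolding T_altdef inner_hadamard norm_cmat_sq by (simp add: scaled_def hadamard_def)
qed

lemma inner_T_bounds:
  "\<gamma> * (Z \<bullet> Z) \<le> Z \<bullet> T Z"
  "(\<And>i j. b i - a j \<le> c) \<Longrightarrow> Z \<bullet> T Z \<le> c * (Z \<bullet> Z)"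
proof -
  have T1: "Z \<bullet> T Z = (\<Sum>i\<in>UNIV. \<Sum>j\<in>UNIV. (b i - a j) * (Z $ i $ j \<bullet> Z $ i $ j))"
    by (simp only: T_altdef inner_hadamard vec_lambda_beta)
  have Z1: "x * (Z \<bullet> Z) = (\<Sum>i\<in>UNIV. \<Sum>j\<in>UNIV. x * (Z $ i $ j \<bullet> Z $ i $ j))" for x
    by (simp only: inner_vec_def sum_distrib_left)
  show "\<gamma> * (Z \<bullet> Z) \<le> Z \<bullet> T Z"
    unfolding T1 Z1 by (intro sum_mono mult_right_mono weight_ge inner_ge_zero)
  show "Z \<bullet> T Z \<le> c * (Z \<bullet> Z)" if "\<And>i j. b i - a j \<le> c"
    unfolding T1 Z1 by (intro sum_mono mult_right_mono that inner_ge_zero)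
qed

lemma norm_scaled_ge: "sqrt \<gamma> * norm Z \<le> norm (scaled Z)"
proof (rule power2_le_imp_le)
  show "(sqrt \<gamma> * norm Z)\<^sup>2 \<le> (norm (scaled Z))\<^sup>2"
    unfolding norm_scaled_sq using inner_T_bounds(1)[of Z] gap
    by (simp add: power_mult_distrib power2_norm_eq_inner)
qed simp

lemma norm_scaled_le:
  obtains c where "c > 0" "\<And>Z. norm (scaled Z) \<le> c * norm Z"
  using bounded_linear.pos_bounded[of scaled] linear_hadamard
  unfolding scaled_def linear_conv_bounded_linear by (metis mult.commute)

text \<open>Cauchy-Schwarz bounds the squared weighted norm, the inner product of Z with T Z, by |Z|
  |T Z|; then |Z| is at most the weighted norm over sqrt \<gamma>, and one factor cancels. It
  transfers the residual bound for T (Y' + L Y) to Y' + L Y.\<close>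

lemma norm_scaled_le_T: "norm (scaled Z) \<le> norm (T Z) / sqrt \<gamma>"
proof (cases "Z = 0")
  case True
  then show ?thesis using gap by (simp add: scaled_def linear_0[OF linear_hadamard] divide_nonneg_nonneg)
next
  case False
  then have pos: "0 < norm (scaled Z)"
    using norm_scaled_ge[of Z] gap by (smt (verit) mult_pos_pos norm_le_zero_iff real_sqrt_gt_zero zero_less_norm_iff)
  have "norm (scaled Z) * norm (scaled Z) = Z \<bullet> T Z"
    using norm_scaled_sq[of Z] by (simp add: power2_eq_square)
  also have "\<dots> \<le> norm Z * norm (T Z)" by (rule norm_cauchy_schwarz)
  also have "\<dots> \<le> (norm (scaled Z) / sqrt \<gamma>) * norm (T Z)"
    using norm_scaled_ge[of Z] gap by (intro mult_right_mono) (simp_all add: field_simps)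
  also have "\<dots> = (norm (T Z) / sqrt \<gamma>) * norm (scaled Z)" by simp
  finally show ?thesis by (rule mult_right_le_imp_le[OF _ pos])
qed

lemma bounded_linear_F': "bounded_linear F'"
  by (rule has_derivative_bounded_linear[OF F_deriv])

lemma linear_M: "linear M"
  using linear_add[OF bounded_linear.linear[OF bounded_linear_F']]
    linear_scale[OF bounded_linear.linear[OF bounded_linear_F']]
  by (intro linearI) (simp_all add: M_def cmat_algebra)

text \<open>Since T L = M, the residual in \<open>step_estimate\<close> is T (Y' + L Y). Hence Y'
  equals - L Y up to a small multiple of |Y| + |Y'|, and the part with Y' is absorbed on the left.
  Rotating W beforehand provides the alignment that the estimate needs.\<close>

theorem local_contraction:
  assumes L: "\<And>Z. T (L Z) = M Z"
    and q: "0 \<le> q" "q < 1" "\<And>Z. norm (scaled (L Z)) \<le> q * norm (scaled Z)"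
  obtains r q' where "r > 0" "0 \<le> q'" "q' < 1"
    "\<And>V W. V \<in> stiefel \<Longrightarrow> aligned V \<Longrightarrow> norm (scaled (ctranspose Vp ** V)) < r \<Longrightarrow>
      trace_minimizer (F V) (W :: ('n,'k) cmat) \<Longrightarrow>
      \<exists>Q. unitary Q \<and> aligned (W ** Q) \<and>
        norm (scaled (ctranspose Vp ** (W ** Q))) \<le> q' * norm (scaled (ctranspose Vp ** V))"
proof -
  \<comment> \<open>A relative error \<theta> gives the rate (q + \<theta>) / (1 - \<theta>); this
    choice makes it (3 q + 1) / (3 + q), which is below 1 for every q < 1.\<close>
  define \<theta> where "\<theta> = (1 - q) / 4"
  define q' where "q' = (3 * q + 1) / (3 + q)"
  have \<theta>: "\<theta> > 0" using q by (simp add: \<theta>_def)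
  have q': "0 \<le> q'" "q' < 1" using q by (simp_all add: q'_def)
  \<comment> \<open>The tolerance \<theta> \<gamma> anticipates two conversions between the norms,
    each costing a factor 1 / sqrt \<gamma>.\<close>
  obtain r where r: "r > 0"
    and small: "\<And>V W. V \<in> stiefel \<Longrightarrow> aligned V \<Longrightarrow> norm (ctranspose Vp ** V) < r \<Longrightarrow>
      trace_minimizer (F V) (W :: ('n,'k) cmat) \<Longrightarrow> norm (ctranspose Vp ** W) < 1"
    and step: "\<And>V W. V \<in> stiefel \<Longrightarrow> aligned V \<Longrightarrow> norm (ctranspose Vp ** V) < r \<Longrightarrow>
      trace_minimizer (F V) W \<Longrightarrow> aligned W \<Longrightarrow>
      norm (T (ctranspose Vp ** W) + M (ctranspose Vp ** V))
        \<le> \<theta> * \<gamma> * (norm (ctranspose Vp ** V) + norm (ctranspose Vp ** W))"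
    using step_estimate[of "\<theta> * \<gamma>"] \<theta> gap by (metis mult_pos_pos)
  show thesis
  proof (rule that[of "sqrt \<gamma> * r" q'])
    show "0 < sqrt \<gamma> * r" using r gap by simp
    show "0 \<le> q'" "q' < 1" by fact+
    fix V W :: "('n,'k) cmat"
    assume V: "V \<in> stiefel" "aligned V" "norm (scaled (ctranspose Vp ** V)) < sqrt \<gamma> * r"
      and W: "trace_minimizer (F V) W"
    define Y where "Y = ctranspose Vp ** V"
    have "sqrt \<gamma> * norm Y < sqrt \<gamma> * r"
      using norm_scaled_ge[of Y] V(3) by (simp add: Y_def)
    then have Yr: "norm Y < r" using gap by simp
    have Wst: "W \<in> stiefel" using W by (simp add: trace_minimizer_def)
    have "norm (ctranspose Vp ** W) < 1" using small[OF V(1,2) _ W] Yr by (simp add: Y_def)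
    then obtain Q :: "('k,'k) cmat" where Q: "unitary Q"
      and al: "norm (ctranspose Vs ** (W ** Q) - mat 1) \<le> CARD('k) * (norm (ctranspose Vp ** W))\<^sup>2"
      using aligned_basis[OF Wst] by blast
    have "norm (ctranspose Vp ** (W ** Q)) = norm (ctranspose Vp ** W)"
      using norm_mult_unitary[of Q "ctranspose Vp ** W"] Q by (simp add: unitary_def matrix_mul_assoc)
    with al have aW: "aligned (W ** Q)" by simp
    define Y' where "Y' = ctranspose Vp ** (W ** Q)"
    have "norm (T Y' + M Y) \<le> \<theta> * \<gamma> * (norm Y + norm Y')"
      unfolding Y_def Y'_def
      by (rule step[OF V(1,2) _ trace_minimizer_mult_unitary[OF W Q] aW]) (use Yr in \<open>simp add: Y_def\<close>)
    then have "norm (T (Y' + L Y)) \<le> \<theta> * \<gamma> * (norm Y + norm Y')"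
      by (simp add: linear_add[OF linear_T] L)
    then have "norm (T (Y' + L Y)) / sqrt \<gamma> \<le> \<theta> * \<gamma> * (norm Y + norm Y') / sqrt \<gamma>"
      using gap by (intro divide_right_mono) auto
    also have "\<dots> = \<theta> * (sqrt \<gamma> * norm Y + sqrt \<gamma> * norm Y')"
    proof -
      have "\<theta> * \<gamma> * (norm Y + norm Y') / sqrt \<gamma> = \<theta> * (\<gamma> / sqrt \<gamma>) * (norm Y + norm Y')" by simp
      also have "\<gamma> / sqrt \<gamma> = sqrt \<gamma>" using gap by (simp add: real_div_sqrt)
      finally show ?thesis by (simp add: algebra_simps)
    qed
    also have "\<dots> \<le> \<theta> * (norm (scaled Y) + norm (scaled Y'))"
      using \<theta> by (intro mult_left_mono add_mono norm_scaled_ge) auto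
    finally have "norm (scaled (Y' + L Y)) \<le> \<theta> * (norm (scaled Y) + norm (scaled Y'))"
      using norm_scaled_le_T[of "Y' + L Y"] by linarith
    moreover have "scaled Y' = scaled (Y' + L Y) - scaled (L Y)"
      by (simp add: scaled_def linear_add[OF linear_hadamard])
    then have "norm (scaled Y') \<le> norm (scaled (Y' + L Y)) + norm (scaled (L Y))"
      by (metis norm_triangle_ineq4)
    ultimately have "(1 - \<theta>) * norm (scaled Y') \<le> (q + \<theta>) * norm (scaled Y)"
      using q(3)[of Y] by (simp add: algebra_simps)
    then have "(3 + q) * norm (scaled Y') \<le> (3 * q + 1) * norm (scaled Y)"
      by (simp add: \<theta>_def field_simps)
    then have "norm (scaled Y') \<le> q' * norm (scaled Y)"
      using q by (simp add: q'_def field_simps)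
    then show "\<exists>Q. unitary Q \<and> aligned (W ** Q) \<and>
        norm (scaled (ctranspose Vp ** (W ** Q))) \<le> q' * norm (scaled (ctranspose Vp ** V))"
      using Q aW by (auto simp: Y_def Y'_def)
  qed
qed

text \<open>Iterates of the contraction, each rotated to an aligned representative. The rotations
  are chosen afresh at every step and disappear from the result, because |Vp^H V| does not see
  them.\<close>

theorem local_convergence:
  assumes L: "\<And>Z. T (L Z) = M Z"
    and q: "0 \<le> q" "q < 1" "\<And>Z. norm (scaled (L Z)) \<le> q * norm (scaled Z)"
  obtains r where "r > 0"
    "\<And>V :: nat \<Rightarrow> ('n,'k) cmat. V 0 \<in> stiefel \<Longrightarrow> norm (ctranspose Vp ** V 0) < r \<Longrightarrow>
      (\<And>i. trace_minimizer (F (V i)) (V (Suc i))) \<Longrightarrow> (\<lambda>i. norm (ctranspose Vp ** V i)) \<longlonglongrightarrow> 0"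
proof -
  obtain r q' where r: "r > 0" and q': "0 \<le> q'" "q' < 1"
    and step: "\<And>V W. V \<in> stiefel \<Longrightarrow> aligned V \<Longrightarrow> norm (scaled (ctranspose Vp ** V)) < r \<Longrightarrow>
      trace_minimizer (F V) (W :: ('n,'k) cmat) \<Longrightarrow>
      \<exists>Q. unitary Q \<and> aligned (W ** Q) \<and>
        norm (scaled (ctranspose Vp ** (W ** Q))) \<le> q' * norm (scaled (ctranspose Vp ** V))"
    using local_contraction[OF assms] by blast
  obtain c where c: "c > 0" "\<And>Z. norm (scaled Z) \<le> c * norm Z" using norm_scaled_le by blast
  show thesis
  \<comment> \<open>The bound 1 permits alignment of the initial basis; r / c brings its weighted
    norm below r.\<close>
  proof (rule that[of "min 1 (r / c)"])
    show "0 < min 1 (r / c)" using r c by simp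
    fix V :: "nat \<Rightarrow> ('n,'k) cmat"
    assume V0: "V 0 \<in> stiefel" "norm (ctranspose Vp ** V 0) < min 1 (r / c)"
      and tm: "\<And>i. trace_minimizer (F (V i)) (V (Suc i))"
    have st: "V i \<in> stiefel" for i
      using V0(1) tm by (cases i) (auto simp: trace_minimizer_def)
    have inv: "norm (ctranspose Vp ** (W ** Q)) = norm (ctranspose Vp ** W)"
      if "unitary Q" for W :: "('n,'k) cmat" and Q :: "('k,'k) cmat"
      using norm_mult_unitary[of Q "ctranspose Vp ** W"] that by (simp add: unitary_def matrix_mul_assoc)
    define w where "w = c * norm (ctranspose Vp ** V 0)"
    have w: "0 \<le> w" "w < r" using V0(2) c by (simp_all add: w_def field_simps)
    have ind: "\<exists>Q. unitary Q \<and> aligned (V i ** Q) \<and> norm (scaled (ctranspose Vp ** (V i ** Q))) \<le> w * q' ^ i" for i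
    proof (induction i)
      case 0
      obtain Q :: "('k,'k) cmat" where Q: "unitary Q"
        and al: "norm (ctranspose Vs ** (V 0 ** Q) - mat 1) \<le> CARD('k) * (norm (ctranspose Vp ** V 0))\<^sup>2"
        using aligned_basis[OF V0(1)] V0(2) by auto
      have "norm (scaled (ctranspose Vp ** (V 0 ** Q))) \<le> w"
        using c(2)[of "ctranspose Vp ** (V 0 ** Q)"] by (simp only: inv[OF Q] w_def)
      then show ?case using Q al inv[OF Q] by auto
    next
      case (Suc i)
      then obtain Q where Q: "unitary Q" "aligned (V i ** Q)"
        "norm (scaled (ctranspose Vp ** (V i ** Q))) \<le> w * q' ^ i" by blast
      have "w * q' ^ i \<le> w" using w q' by (simp add: mult_left_le power_le_one)
      with Q(3) w(2) have lt: "norm (scaled (ctranspose Vp ** (V i ** Q))) < r" by linarith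
      \<comment> \<open>The next iterate was computed from V i, yet it is also a step from the
        rotated basis, since F takes the same value at both.\<close>
      have tm': "trace_minimizer (F (V i ** Q)) (V (Suc i))" using tm by (simp add: F_inv[OF Q(1)])
      obtain Q' where Q': "unitary Q'" "aligned (V (Suc i) ** Q')"
        "norm (scaled (ctranspose Vp ** (V (Suc i) ** Q'))) \<le> q' * norm (scaled (ctranspose Vp ** (V i ** Q)))"
        using step[OF stiefel_mult_unitary[OF st Q(1)] Q(2) lt tm'] by blast
      note Q'(3)
      also have "q' * norm (scaled (ctranspose Vp ** (V i ** Q))) \<le> q' * (w * q' ^ i)"
        by (intro mult_left_mono Q(3) q')
      finally show ?case using Q'(1,2) by (auto simp: mult_ac)
    qed
    have bound: "norm (ctranspose Vp ** V i) \<le> w / sqrt \<gamma> * q' ^ i" for i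
    proof -
      obtain Q where Q: "unitary Q" "norm (scaled (ctranspose Vp ** (V i ** Q))) \<le> w * q' ^ i"
        using ind by blast
      have "sqrt \<gamma> * norm (ctranspose Vp ** V i) \<le> w * q' ^ i"
        using norm_scaled_ge[of "ctranspose Vp ** (V i ** Q)"] Q(2) by (simp only: inv[OF Q(1)])
      then show ?thesis using gap by (simp add: field_simps)
    qed
    have "(\<lambda>i. w / sqrt \<gamma> * q' ^ i) \<longlonglongrightarrow> w / sqrt \<gamma> * 0"
      by (intro tendsto_mult tendsto_const LIMSEQ_realpow_zero q')
    then have "(\<lambda>i. w / sqrt \<gamma> * q' ^ i) \<longlonglongrightarrow> 0" by simp
    then show "(\<lambda>i. norm (ctranspose Vp ** V i)) \<longlonglongrightarrow> 0"
      by (rule Lim_null_comparison[rotated]) (simp only: real_norm_def abs_norm_cancel bound eventually_True)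
  qed
qed

end

section \<open>Level-shifted SCF\<close>

lemma has_derivative_cmatI:
  fixes H :: "'x::real_normed_vector \<Rightarrow> ('a::finite,'b::finite) cmat"
  assumes "\<And>i j. ((\<lambda>x. H x $ i $ j) has_derivative (\<lambda>x. H' x $ i $ j)) (at V)"
  shows "(H has_derivative H') (at V)"
  unfolding has_derivative_componentwise_within[of H]
proof
  fix e :: "('a,'b) cmat" assume "e \<in> Basis"
  then obtain i j c where e: "e = axis i (axis j c)"
    by (auto simp: Basis_vec_def)
  show "((\<lambda>x. H x \<bullet> e) has_derivative (\<lambda>x. H' x \<bullet> e)) (at V)"
    using has_derivative_inner_left[OF assms[of i j], of c] by (simp add: e inner_axis)
qed

lemma differentiable_entries_has_derivative:
  assumes "differentiable_entries H"
  obtains H' where "(H has_derivative H') (at V)"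
proof -
  have "\<forall>i j. \<exists>f'. ((\<lambda>V. H V $ i $ j) has_derivative f') (at V)"
  proof (intro allI)
    fix i j
    have "C_diff (Suc 0) (\<lambda>V. H V $ i $ j)"
      using assms unfolding differentiable_entries_def smooth_def by blast
    then show "\<exists>f'. ((\<lambda>V. H V $ i $ j) has_derivative f') (at V)" by auto
  qed
  then obtain f' where "\<And>i j. ((\<lambda>V. H V $ i $ j) has_derivative f' i j) (at V)" by metis
  then have "(H has_derivative (\<lambda>X. \<chi> i j. f' i j X)) (at V)"
    by (intro has_derivative_cmatI) simp
  then show thesis by (rule that)
qed

lemma dirderiv_eq:
  assumes "(H has_derivative H') (at V)"
  shows "dirderiv H V X = H' X"
proof -
  have "((\<lambda>t::real. V + t *\<^sub>R X) has_derivative (\<lambda>t. t *\<^sub>R X)) (at 0)"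
    by (auto intro!: derivative_eq_intros)
  moreover have "(H has_derivative H') (at (V + 0 *\<^sub>R X))" using assms by simp
  ultimately have "((\<lambda>t::real. H (V + t *\<^sub>R X)) has_derivative (\<lambda>t. H' (t *\<^sub>R X))) (at 0)"
    by (rule has_derivative_compose)
  then have "((\<lambda>t::real. H (V + t *\<^sub>R X)) has_vector_derivative H' X) (at 0)"
    by (simp add: has_vector_derivative_def linear_scale[OF has_derivative_linear[OF assms]])
  then show ?thesis unfolding dirderiv_def by (rule vector_derivative_at)
qed

lemma level_shifted_has_derivative:
  fixes H :: "('n::finite,'k::finite) cmat \<Rightarrow> ('n,'n) cmat"
  assumes "(H has_derivative H') (at V)"
  shows "(level_shifted \<sigma> H has_derivative
    (\<lambda>X. H' X - \<sigma> *\<^sub>R (V ** ctranspose X + X ** ctranspose V))) (at V)"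
proof -
  have "((\<lambda>V. ctranspose V) has_derivative ctranspose) (at V)"
    by (rule bounded_linear_imp_has_derivative[OF bounded_linear_ctranspose])
  from bounded_bilinear.FDERIV[OF bounded_bilinear_matrix_mult has_derivative_ident this]
  have "((\<lambda>V. V ** ctranspose V) has_derivative (\<lambda>X. V ** ctranspose X + X ** ctranspose V)) (at V)" .
  from has_derivative_diff[OF assms has_derivative_scaleR_right[OF this, of \<sigma>]]
  show ?thesis unfolding level_shifted_def .
qed

lemma hermitian_level_shifted: "hermitian (H V) \<Longrightarrow> hermitian (level_shifted \<sigma> H V)"
  by (simp add: hermitian_def level_shifted_def)

lemma level_shifted_mult_unitary:
  assumes "unitary Q" "H (V ** Q) = H V"
  shows "level_shifted \<sigma> H (V ** Q) = level_shifted \<sigma> H V"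
proof -
  have "V ** Q ** ctranspose (V ** Q) = V ** (Q ** ctranspose Q) ** ctranspose V"
    by (simp add: matrix_mul_assoc)
  then show ?thesis using assms by (simp add: level_shifted_def unitary_def)
qed

text \<open>Read n, t and x as the inner products of Z with Z, T Z and Q Z. Then x / t lies between
  \<mu>min / u and \<mu>max / g, and x - t is the form of T L.\<close>

lemma weighted_form_bounds:
  fixes t x \<mu>max \<mu>min g u n :: real
  assumes "0 < g" "0 \<le> n" "g * n \<le> t" "t \<le> u * n" "0 < u"
    and "\<mu>min * n \<le> x" "x \<le> \<mu>max * n" "0 \<le> \<mu>min" "0 \<le> \<mu>max"
  shows "\<bar>x - t\<bar> \<le> max (\<mu>max / g - 1) (1 - \<mu>min / u) * t"
proof -
  have t: "0 \<le> t" using assms(1-3) by (meson mult_nonneg_nonneg less_imp_le order_trans)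
  have "x \<le> \<mu>max / g * (g * n)" using assms by simp
  also have "\<dots> \<le> \<mu>max / g * t" using assms by (intro mult_left_mono) auto
  finally have "x - t \<le> (\<mu>max / g - 1) * t" by (simp add: algebra_simps)
  also have "\<dots> \<le> max (\<mu>max / g - 1) (1 - \<mu>min / u) * t" using t by (intro mult_right_mono) auto
  finally have 1: "x - t \<le> max (\<mu>max / g - 1) (1 - \<mu>min / u) * t" .
  have "\<mu>min / u * t \<le> \<mu>min / u * (u * n)" using assms by (intro mult_left_mono) auto
  also have "\<dots> \<le> x" using assms by simp
  finally have "t - x \<le> (1 - \<mu>min / u) * t" by (simp add: algebra_simps)
  also have "\<dots> \<le> max (\<mu>max / g - 1) (1 - \<mu>min / u) * t" using t by (intro mult_right_mono) auto
  finally show ?thesis using 1 by linarith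
qed

text \<open>Spectral radius below 1 and convergence are asserted for the strict bound, and spectral
  radius at most 1 for the nonstrict one. At \<sigma> = \<mu>max / 2 - \<delta> the value 1 can
  occur: for a constant H with n = 2 and k = 1 one has \<mu>max = \<delta> and \<sigma> = - \<delta>
  / 2, and the operator is the identity.\<close>

theorem mainTheorem3:
  fixes H :: "('n::finite, 'k::{finite,linorder}) cmat \<Rightarrow> ('n, 'n) cmat"
    and Vs :: "('n, 'k) cmat"
    and Vp :: "('n, 'm::{finite,linorder}) cmat"
    and \<Lambda> :: "('k, 'k) cmat" and \<Lambda>p :: "('m, 'm) cmat"
    and \<delta> s \<mu>max \<mu>min :: real
  assumes dim: "CARD('n) = CARD('k) + CARD('m)"
    and cont: "continuous_on UNIV H"
    and herm: "\<And>V. hermitian (H V)"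
    and invariant: "\<And>V Q. unitary Q \<Longrightarrow> H (V ** Q) = H V"
    and diff: "differentiable_entries H"
    and sol: "nepv_solution H Vs"
    and unit: "unitary (hcat Vs Vp)"
    and \<Lambda>: "\<Lambda> = diag (\<lambda>j. of_real (lam (pos j) (H Vs)))"
    and \<Lambda>p: "\<Lambda>p = diag (\<lambda>i. of_real (lam (CARD('k) + pos i) (H Vs)))"
    and eig: "H Vs ** Vs = Vs ** \<Lambda>" "H Vs ** Vp = Vp ** \<Lambda>p"
    and \<delta>: "\<delta> = lam (CARD('k) + 1) (H Vs) - lam CARD('k) (H Vs)"
    and gap: "\<delta> > 0"
    and s: "s = lam CARD('n) (H Vs) - lam 1 (H Vs)"
    and Q_sa: "self_adjoint (Q_op H Vs Vp \<Lambda> \<Lambda>p)"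
    and Q_pd: "positive_definite (Q_op H Vs Vp \<Lambda> \<Lambda>p)"
    and \<mu>max: "\<mu>max = largest_eigenvalue (Q_op H Vs Vp \<Lambda> \<Lambda>p)"
    and \<mu>min: "\<mu>min = smallest_eigenvalue (Q_op H Vs Vp \<Lambda> \<Lambda>p)"
  shows "\<forall>\<sigma>. \<sigma> > - \<delta> \<longrightarrow>
      (0 < \<mu>min / (\<sigma> + s) \<and> \<mu>min / (\<sigma> + s) \<le> \<mu>max / (\<sigma> + \<delta>) \<and> \<mu>max / (\<sigma> + \<delta>) < 2
        \<longrightarrow> op_spectral_radius (L_op \<sigma> H Vs Vp) < 1)
    \<and> (0 < \<mu>min / (\<sigma> + s) \<and> \<mu>min / (\<sigma> + s) \<le> \<mu>max / (\<sigma> + \<delta>) \<and> \<mu>max / (\<sigma> + \<delta>) < 2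
        \<longleftrightarrow> \<sigma> > \<mu>max / 2 - \<delta>)
    \<and> (\<sigma> > \<mu>max / 2 - \<delta> \<longrightarrow> op_spectral_radius (L_op \<sigma> H Vs Vp) < 1)
    \<and> (0 < \<mu>min / (\<sigma> + s) \<and> \<mu>min / (\<sigma> + s) \<le> \<mu>max / (\<sigma> + \<delta>) \<and> \<mu>max / (\<sigma> + \<delta>) \<le> 2
        \<longrightarrow> op_spectral_radius (L_op \<sigma> H Vs Vp) \<le> 1)
    \<and> (0 < \<mu>min / (\<sigma> + s) \<and> \<mu>min / (\<sigma> + s) \<le> \<mu>max / (\<sigma> + \<delta>) \<and> \<mu>max / (\<sigma> + \<delta>) \<le> 2
        \<longleftrightarrow> \<sigma> \<ge> \<mu>max / 2 - \<delta>)
    \<and> (\<forall>N. \<sigma> > \<mu>max / 2 - \<delta> \<and> unitarily_invariant_norm N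
        \<longrightarrow> locally_convergent N \<sigma> H Vs)"
proof (intro allI impI)
  fix \<sigma> assume \<sigma>: "\<sigma> > - \<delta>"
  define F where "F = level_shifted \<sigma> H"
  \<comment> \<open>The term \<sigma> Vs Vs^H lowers the eigenvalues on the range of Vs by \<sigma>
    and leaves those on the range of Vp alone, so the gap becomes \<sigma> + \<delta>.\<close>
  define a where "a j = lam (pos j) (H Vs) - \<sigma>" for j :: 'k
  define b where "b i = lam (CARD('k) + pos i) (H Vs)" for i :: 'm
  obtain H' where H': "(H has_derivative H') (at Vs)"
    using differentiable_entries_has_derivative[OF diff] .
  define F' where "F' X = H' X - \<sigma> *\<^sub>R (Vs ** ctranspose X + X ** ctranspose Vs)" for X
  have F': "(F has_derivative F') (at Vs)"
    unfolding F_def F'_def by (rule level_shifted_has_derivative[OF H'])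
  note lam_le = lam_mono[OF herm[of Vs]]
  have m1: "CARD('m) \<ge> 1" by (simp add: Suc_le_eq card_gt_0_iff)
  have k1: "CARD('k) \<ge> 1" by (simp add: Suc_le_eq card_gt_0_iff)
  interpret unitary_split Vs Vp by unfold_locales (rule unit)
  interpret invariant_subspace_iteration Vs Vp F F' a b "lam CARD('k) (H Vs) - \<sigma>" "\<sigma> + \<delta>"
  proof
    show "hermitian (F V)" for V unfolding F_def by (intro hermitian_level_shifted herm)
    show "F (V ** Q) = F V" if "unitary Q" for V and Q :: "('k,'k) cmat"
      unfolding F_def by (intro level_shifted_mult_unitary invariant that)
    have "F Vs ** Vs = Vs ** \<Lambda> - \<sigma> *\<^sub>R (Vs ** (ctranspose Vs ** Vs))"
      by (simp add: F_def level_shifted_def cmat_algebra eig)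
    also have "\<dots> = Vs ** diag (\<lambda>j. of_real (a j))"
      by (simp add: Vs_Vs \<Lambda> a_def vec_eq_iff algebra_simps) (simp add: scaleR_conv_of_real)
    finally show "F Vs ** Vs = Vs ** diag (\<lambda>j. of_real (a j))" .
    have "F Vs ** Vp = Vp ** \<Lambda>p - \<sigma> *\<^sub>R (Vs ** (ctranspose Vs ** Vp))"
      by (simp add: F_def level_shifted_def cmat_algebra eig)
    then show "F Vs ** Vp = Vp ** diag (\<lambda>i. of_real (b i))"
      by (simp add: Vs_Vp \<Lambda>p b_def)
    show "a j \<le> lam CARD('k) (H Vs) - \<sigma>" for j
      using lam_le[of "pos j" "CARD('k)"] pos_bounds[of j] dim by (simp add: a_def)
    show "lam CARD('k) (H Vs) - \<sigma> + (\<sigma> + \<delta>) \<le> b i" for i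
      using lam_le[of "CARD('k) + 1" "CARD('k) + pos i"] pos_bounds[of i] dim by (simp add: b_def \<delta>)
  qed (use F' \<sigma> in simp_all)
  have weight_le: "b i - a j \<le> \<sigma> + s" for i j
    using lam_le[of "CARD('k) + pos i" "CARD('n)"] lam_le[of 1 "pos j"] pos_bounds[of i] pos_bounds[of j] dim
    by (simp add: a_def b_def s)
  have \<delta>s: "\<delta> \<le> s"
    using lam_le[of "CARD('k) + 1" "CARD('n)"] lam_le[of 1 "CARD('k)"] k1 m1 dim by (simp add: \<delta> s)
  define Q where "Q = Q_op H Vs Vp \<Lambda> \<Lambda>p"
  define L where "L = L_op \<sigma> H Vs Vp"
  have TL: "T (L Z) = M Z" for Z
  proof -
    have "T (L Z) $ i $ j = M Z $ i $ j" for i j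
    proof -
      have "b i - a j \<noteq> 0" using weight_ge[of i j] \<sigma> by simp
      then have cancel: "of_real (b i - a j) * (of_real (1 / (b i - a j)) * x) = x" for x :: complex
        unfolding mult.assoc[symmetric] of_real_mult[symmetric] by simp
      have "L Z $ i $ j = of_real (1 / (b i - a j)) * M Z $ i $ j"
        unfolding L_def L_op_def F_def[symmetric] dirderiv_eq[OF F'] M_def hadamard_def D_shift_def
        by (simp add: a_def b_def algebra_simps)
      then show ?thesis by (simp only: T_nth cancel)
    qed
    then show ?thesis by (simp add: vec_eq_iff)
  qed
  \<comment> \<open>In the derivative of V V^H along Vp Z, one term dies by Vp^H Vs = 0 and the
    other gives Z. The resulting - \<sigma> Z is exactly offset by the \<sigma> Z contained in T, so
    M + T does not depend on \<sigma>.\<close>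
  have MQ: "M Z = Q Z - T Z" for Z
  proof -
    have "ctranspose Vp ** (Vs ** ctranspose (Vp ** Z) + (Vp ** Z) ** ctranspose Vs) ** Vs
      = (ctranspose Vp ** Vs) ** ctranspose (Vp ** Z) ** Vs + (ctranspose Vp ** Vp) ** Z ** (ctranspose Vs ** Vs)"
      by (simp add: cmat_algebra)
    then have "M Z = ctranspose Vp ** H' (Vp ** Z) ** Vs - \<sigma> *\<^sub>R Z"
      by (simp add: M_def F'_def matrix_diff_ldistrib matrix_diff_rdistrib matrix_scaleR_left
          matrix_scaleR_right Vs_Vs Vp_Vp Vp_Vs)
    moreover have "T Z = \<Lambda>p ** Z - Z ** \<Lambda> + \<sigma> *\<^sub>R Z"
      by (simp add: vec_eq_iff T_nth a_def b_def \<Lambda> \<Lambda>p algebra_simps) (simp add: scaleR_conv_of_real)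
    ultimately show ?thesis
      by (simp add: Q_def Q_op_def dirderiv_eq[OF H'])
  qed
  have linear_Q: "linear Q"
  proof -
    have "Q = (\<lambda>Z. M Z + T Z)" by (simp add: MQ fun_eq_iff)
    then show ?thesis using linear_compose_add[OF linear_M linear_T] by simp
  qed
  have Q_sym: "X \<bullet> Q Z = Q X \<bullet> Z" for X Z
    using Q_sa by (simp add: self_adjoint_def Q_def inner_cmat)
  \<comment> \<open>With T the identity, the extreme eigenvalues of Q bound its form; the
    interpretation for L rests on T L = Q - T, a difference of symmetric operators.\<close>
  interpret Q: weighted_self_adjoint "\<lambda>Z. Z" Q
    by (intro weighted_self_adjoint.intro linear_Q linear_ident) (simp_all add: Q_sym)
  interpret L: weighted_self_adjoint T L
  proof (rule weighted_self_adjoint.intro)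
    show "linear L"
    proof -
      have "L = (\<lambda>Z. hadamard (D_shift \<sigma> (H Vs)) (M Z))"
        by (simp add: fun_eq_iff L_def L_op_def M_def F_def[symmetric] dirderiv_eq[OF F'])
      then show ?thesis using linear_compose[OF linear_M linear_hadamard] by (simp add: o_def)
    qed
    show "0 < X \<bullet> T X" if "X \<noteq> 0" for X
      using that inner_T_bounds(1)[of X] \<sigma>
      by (smt (verit) inner_gt_zero_iff mult_pos_pos)
    show "X \<bullet> T (L Z) = T (L X) \<bullet> Z" for X Z
      by (simp add: TL MQ inner_diff_left inner_diff_right Q_sym T_sym)
  qed (rule linear_T T_sym)+
  have \<mu>: "\<mu>min * (Z \<bullet> Z) \<le> Z \<bullet> Q Z" "Z \<bullet> Q Z \<le> \<mu>max * (Z \<bullet> Z)" for Z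
    unfolding \<mu>min \<mu>max Q_def[symmetric]
    using Q.smallest_eigenvalue_lower Q.largest_eigenvalue_upper by blast+
  have \<mu>min_pos: "\<mu>min > 0"
  proof -
    have "op_eigenvalue Q (of_real \<mu>min)"
      unfolding \<mu>min Q_def[symmetric] by (rule Q.op_eigenvalue_smallest)
    then obtain m Z where mZ: "complex_of_real \<mu>min = of_real m" "Z \<noteq> 0" "Q Z = m *\<^sub>R Z"
      by (rule Q.op_eigenvalue_real)
    have "Z \<bullet> Q Z > 0" using Q_pd mZ(2) by (simp add: positive_definite_def Q_def inner_cmat)
    then show ?thesis using mZ inner_ge_zero[of Z] by (simp add: zero_less_mult_iff not_less[symmetric])
  qed
  have \<mu>le: "\<mu>min \<le> \<mu>max"
  proof -
    obtain Z :: "('m,'k) cmat" where "norm Z = 1" using vector_choose_size[of 1] by auto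
    then have "Z \<bullet> Z = 1" by (simp add: norm_eq_1)
    then show ?thesis using \<mu>[of Z] by simp
  qed
  have pos: "\<sigma> + \<delta> > 0" "\<sigma> + s > 0" using \<sigma> \<delta>s by simp_all
  have c1: "0 < \<mu>min / (\<sigma> + s)" using \<mu>min_pos pos by simp
  have c2: "\<mu>min / (\<sigma> + s) \<le> \<mu>max / (\<sigma> + \<delta>)"
    using \<mu>min_pos \<mu>le pos \<delta>s by (intro frac_le) auto
  have lt2: "\<mu>max / (\<sigma> + \<delta>) < 2 \<longleftrightarrow> \<sigma> > \<mu>max / 2 - \<delta>"
    and le2: "\<mu>max / (\<sigma> + \<delta>) \<le> 2 \<longleftrightarrow> \<sigma> \<ge> \<mu>max / 2 - \<delta>"
    using pos by (auto simp: field_simps)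
  define q where "q = max (\<mu>max / (\<sigma> + \<delta>) - 1) (1 - \<mu>min / (\<sigma> + s))"
  have form: "\<bar>Z \<bullet> T (L Z)\<bar> \<le> q * (Z \<bullet> T Z)" for Z
  proof -
    have "\<bar>Z \<bullet> Q Z - Z \<bullet> T Z\<bar> \<le> q * (Z \<bullet> T Z)"
      unfolding q_def using inner_T_bounds(1)[of Z] inner_T_bounds(2)[OF weight_le, of Z] \<mu> pos \<mu>min_pos \<mu>le
      by (intro weighted_form_bounds[where n = "Z \<bullet> Z"]) auto
    then show ?thesis by (simp add: TL MQ inner_diff_right)
  qed
  have \<rho>: "op_spectral_radius L \<le> q" by (rule L.op_spectral_radius_le[OF form])
  \<comment> \<open>The second entry of the maximum is below 1 because \<mu>min / (\<sigma> + s) >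
    0; only the first one constrains \<sigma>.\<close>
  have q_lt: "q < 1" if "\<mu>max / (\<sigma> + \<delta>) < 2" using that c1 by (simp add: q_def)
  have q_le: "q \<le> 1" if "\<mu>max / (\<sigma> + \<delta>) \<le> 2" using that c1 by (simp add: q_def)
  have conv: "locally_convergent N \<sigma> H Vs"
    if \<sigma>2: "\<sigma> > \<mu>max / 2 - \<delta>" and N: "unitarily_invariant_norm N" for N
  proof -
    \<comment> \<open>\<open>weighted_contraction\<close> divides by its constant, whereas q may be
      0.\<close>
    define q' where "q' = max q (1 / 2)"
    have q': "0 < q'" "q' < 1" using q_lt \<sigma>2 lt2 by (auto simp: q'_def)
    have "\<bar>Z \<bullet> T (L Z)\<bar> \<le> q' * (Z \<bullet> T Z)" for Z
      using form[of Z] mult_right_mono[of q q' "Z \<bullet> T Z"] L.T_nonneg[of Z] by (simp add: q'_def)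
    then have "L Z \<bullet> T (L Z) \<le> q'\<^sup>2 * (Z \<bullet> T Z)" for Z
      using L.weighted_contraction q'(1) by blast
    then have "(norm (scaled (L Z)))\<^sup>2 \<le> (q' * norm (scaled Z))\<^sup>2" for Z
      by (simp add: norm_scaled_sq power_mult_distrib)
    then have contr: "norm (scaled (L Z)) \<le> q' * norm (scaled Z)" for Z
      using q'(1) by (meson power2_le_imp_le less_imp_le mult_nonneg_nonneg norm_ge_zero)
    obtain r where r: "r > 0" and lim: "\<And>V :: nat \<Rightarrow> ('n,'k) cmat. V 0 \<in> stiefel \<Longrightarrow>
        norm (ctranspose Vp ** V 0) < r \<Longrightarrow> (\<And>i. trace_minimizer (F (V i)) (V (Suc i))) \<Longrightarrow>
        (\<lambda>i. norm (ctranspose Vp ** V i)) \<longlonglongrightarrow> 0"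
      using local_convergence[OF TL less_imp_le[OF q'(1)] q'(2) contr] by blast
    obtain c d where cd: "c > 0" "d > 0" "\<And>A. c * norm A \<le> N A" "\<And>A. N A \<le> d * norm A"
      using unitarily_invariant_norm_equiv[OF N] by blast
    have angles: "norm (ctranspose Vp ** V) \<le> norm (canonical_angles V Vs)"
      "norm (canonical_angles V Vs) \<le> 3 * norm (ctranspose Vp ** V)" if "V \<in> stiefel" for V
      using canonical_angles_bounds[OF that, of "canonical_angles V Vs"]
      by (simp_all add: canonical_angles_def)
    show ?thesis
      unfolding locally_convergent_def
    \<comment> \<open>The lower equivalence constant c of N turns the bound on the distance into a
      bound r on the Frobenius norm of the angles, which dominates |Vp^H V 0|.\<close>
    proof (intro exI[of _ "c * r"] conjI allI impI)
      show "c * r > 0" using cd(1) r by simp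
      fix V assume scf: "level_shifted_scf \<sigma> H V" and close: "subspace_dist N (V 0) Vs < c * r"
      have tm: "trace_minimizer (F (V i)) (V (Suc i))" for i
        using scf by (intro smallest_eigenbasis_trace_minimizer F_herm) (simp add: level_shifted_scf_def F_def)
      have st: "V i \<in> stiefel" for i
        using scf tm by (cases i) (auto simp: level_shifted_scf_def trace_minimizer_def)
      have "c * norm (canonical_angles (V 0) Vs) < c * r"
        using cd(3) close unfolding subspace_dist_def by (rule order.strict_trans1)
      then have "norm (canonical_angles (V 0) Vs) < r" using cd(1) by simp
      then have "norm (ctranspose Vp ** V 0) < r" using angles(1)[OF st[of 0]] by linarith
      then have "(\<lambda>i. norm (ctranspose Vp ** V i)) \<longlonglongrightarrow> 0" using lim st tm by blast
      then have "(\<lambda>i. 3 * d * norm (ctranspose Vp ** V i)) \<longlonglongrightarrow> 3 * d * 0"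
        by (intro tendsto_mult tendsto_const)
      then have lim0: "(\<lambda>i. 3 * d * norm (ctranspose Vp ** V i)) \<longlonglongrightarrow> 0" by simp
      have "norm (subspace_dist N (V i) Vs) \<le> 3 * d * norm (ctranspose Vp ** V i)" for i
      proof -
        have "N (canonical_angles (V i) Vs) \<le> d * (3 * norm (ctranspose Vp ** V i))"
          using cd(2,4) angles(2)[OF st[of i]] by (meson less_imp_le mult_left_mono order_trans)
        moreover have "0 \<le> N (canonical_angles (V i) Vs)"
          using N by (simp add: unitarily_invariant_norm_def)
        ultimately show ?thesis by (simp add: subspace_dist_def)
      qed
      then show "(\<lambda>i. subspace_dist N (V i) Vs) \<longlonglongrightarrow> 0"
        by (intro Lim_null_comparison[OF _ lim0] always_eventually allI)
    qed
  qed
  show "(0 < \<mu>min / (\<sigma> + s) \<and> \<mu>min / (\<sigma> + s) \<le> \<mu>max / (\<sigma> + \<delta>) \<and> \<mu>max / (\<sigma> + \<delta>) < 2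
        \<longrightarrow> op_spectral_radius (L_op \<sigma> H Vs Vp) < 1)
    \<and> (0 < \<mu>min / (\<sigma> + s) \<and> \<mu>min / (\<sigma> + s) \<le> \<mu>max / (\<sigma> + \<delta>) \<and> \<mu>max / (\<sigma> + \<delta>) < 2
        \<longleftrightarrow> \<sigma> > \<mu>max / 2 - \<delta>)
    \<and> (\<sigma> > \<mu>max / 2 - \<delta> \<longrightarrow> op_spectral_radius (L_op \<sigma> H Vs Vp) < 1)
    \<and> (0 < \<mu>min / (\<sigma> + s) \<and> \<mu>min / (\<sigma> + s) \<le> \<mu>max / (\<sigma> + \<delta>) \<and> \<mu>max / (\<sigma> + \<delta>) \<le> 2
        \<longrightarrow> op_spectral_radius (L_op \<sigma> H Vs Vp) \<le> 1)
    \<and> (0 < \<mu>min / (\<sigma> + s) \<and> \<mu>min / (\<sigma> + s) \<le> \<mu>max / (\<sigma> + \<delta>) \<and> \<mu>max / (\<sigma> + \<delta>) \<le> 2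
        \<longleftrightarrow> \<sigma> \<ge> \<mu>max / 2 - \<delta>)
    \<and> (\<forall>N. \<sigma> > \<mu>max / 2 - \<delta> \<and> unitarily_invariant_norm N
        \<longrightarrow> locally_convergent N \<sigma> H Vs)"
    using c1 c2 lt2 le2 conv \<rho> q_lt q_le unfolding L_def
    by (meson order.strict_trans1 order_trans)
qed

end
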